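(* Let $A\in\mathbb{R}^{n\times n}$ be real and normal with simple complex spectrum, and let $\mathcal{Z}_O(A)=\{R\in O(n)\mid RA=AR\}$. For every sufficiently small $T>0$ the following holds: if $b_T^0$ is any unit vector with $\lambda_{\min}(G_T(A,b_T^0))=\gamma_1(A,T)$, then $$\{b\in\mathbb{R}^n\mid\Vert b\Vert=1,\ \lambda_{\min}(G_T(A,b))=\gamma_1(A,T)\}=\{Rb_T^0\mid R\in\mathcal{Z}_O(A)\}.$$ If the spectrum of $A$ contains $r$ real eigenvalues and $q$ nonreal conjugate pairs, then $\mathcal{Z}_O(A)$ is isomorphic to $\{-1,1\}^r\times(S^1)^q$. In particular, if $A$ is symmetric with simple spectrum, then for every sufficiently small $T>0$ there are exactly $2^n$ maximizing unit vectors, forming $2^{n-1}$ lines.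
   Context: For $A\in\mathbb{R}^{n\times n}$, $T>0$ and $b\in\mathbb{R}^n$, $G_T(A,b)=\int_0^Te^{tA}bb^\top e^{tA^\top}\,dt$ and $\gamma_1(A,T)=\max_{\Vert b\Vert=1}\lambda_{\min}(G_T(A,b))$. $O(n)$ is the real orthogonal group and $S^1$ the circle group. *)

theory Defs
  imports
    "HOL-Analysis.Analysis"
    "HOL-Computational_Algebra.Polynomial"
    "HOL-Algebra.Product_Groups"
    "HOL-Algebra.Sym_Groups"
begin

subsection \<open>Spectra of square matrices\<close>

definition eigenvalues :: "'a::field^'n^'n \<Rightarrow> 'a set" where
  "eigenvalues M = {l. \<exists>v. v \<noteq> 0 \<and> M *v v = l *s v}"

definition charpoly :: "'a::comm_ring_1^'n^'n \<Rightarrow> 'a poly" where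
  "charpoly M = det (mat [:0, 1:] - map_matrix (\<lambda>a. [:a:]) M)"

definition complex_spectrum :: "real^'n^'n \<Rightarrow> complex set" where
  "complex_spectrum A = eigenvalues (map_matrix complex_of_real A)"

text \<open>The qualified name is needed because HOL-Algebra reuses the name for the order of a group;
  here it is the multiplicity of a root.\<close>

definition simple_spectrum :: "real^'n^'n \<Rightarrow> bool" where
  "simple_spectrum A \<longleftrightarrow>
     (\<forall>z\<in>complex_spectrum A. Polynomial.order z (charpoly (map_matrix complex_of_real A)) = 1)"

definition normal_matrix :: "real^'n^'n \<Rightarrow> bool" where
  "normal_matrix A \<longleftrightarrow> A ** transpose A = transpose A ** A"

text \<open>Only used for symmetric matrices, whose eigenvalues form a finite nonempty set of reals.\<close>

definition lambda_min :: "real^'n^'n \<Rightarrow> real" where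
  "lambda_min M = Min (eigenvalues M)"

subsection \<open>The finite-horizon Gramian\<close>

text \<open>The library's exponential does not apply: the type of square matrices is not an instance of
  a normed algebra under the matrix product.\<close>

definition matrix_exp :: "real^'n^'n \<Rightarrow> real^'n^'n" where
  "matrix_exp M = (\<Sum>k. (1 / fact k) *\<^sub>R (((**) M) ^^ k) (mat 1))"

definition gramian :: "real \<Rightarrow> real^'n^'n \<Rightarrow> real^'n \<Rightarrow> real^'n^'n" where
  "gramian T A b = integral {0..T} (\<lambda>t.
     matrix_exp (t *\<^sub>R A) ** (columnvector b ** (rowvector b :: real^'n^1))
       ** matrix_exp (t *\<^sub>R transpose A))"

text \<open>The supremum is a maximum: the smallest eigenvalue of the Gramian depends continuously on
  \<open>b\<close>, and the unit sphere is compact.\<close>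

definition gamma1 :: "real^'n^'n \<Rightarrow> real \<Rightarrow> real" where
  "gamma1 A T = (SUP b\<in>{b. norm b = 1}. lambda_min (gramian T A b))"

subsection \<open>Groups\<close>

definition orthogonal_centralizer :: "real^'n^'n \<Rightarrow> (real^'n^'n) monoid" where
  "orthogonal_centralizer A =
     \<lparr>carrier = {R. orthogonal_matrix R \<and> R ** A = A ** R}, mult = (**), one = mat 1\<rparr>"

definition circle_group :: "complex monoid" where
  "circle_group = \<lparr>carrier = {z. norm z = 1}, mult = (*), one = 1\<rparr>"

text \<open>\<open>sign_img\<close> is the library's multiplicative group \<open>{-1, 1}\<close> of integers.\<close>

definition sign_circle_group :: "nat \<Rightarrow> nat \<Rightarrow> ((nat \<Rightarrow> int) \<times> (nat \<Rightarrow> complex)) monoid" where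
  "sign_circle_group r q =
     product_group {..<r} (\<lambda>_. sign_img) \<times>\<times> product_group {..<q} (\<lambda>_. circle_group)"

text \<open>The compact groups involved are compared as topological groups; this topology is the product
  topology on the carrier of \<open>sign_circle_group r q\<close>.\<close>

definition sign_circle_topology ::
    "nat \<Rightarrow> nat \<Rightarrow> ((nat \<Rightarrow> int) \<times> (nat \<Rightarrow> complex)) topology" where
  "sign_circle_topology r q =
     prod_topology (product_topology (\<lambda>_. top_of_set (carrier sign_img)) {..<r})
       (product_topology (\<lambda>_. top_of_set (carrier circle_group)) {..<q})"

end

theory Submission
  imports Defs "HOL-Computational_Algebra.Fundamental_Theorem_Algebra"
begin

text \<open>
  In coordinates with respect to an orthonormal basis of complex eigenvectors \<open>v\<^sub>k\<close>, with eigenvalues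
  \<open>e\<^sub>k\<close>, the form \<open>x \<bullet> G\<^sub>T(A, b) x\<close> is the energy \<open>\<integral>|\<Sum> c\<^sub>k exp (t e\<^sub>k)|\<^sup>2 dt\<close> over \<open>[0, T]\<close> of the exponential
  sum with coefficients \<open>c\<^sub>k = cnj x\<^sub>k \<cdot> b\<^sub>k\<close>, while \<open>\<parallel>x\<parallel>\<^sup>2 = \<Sum> |c\<^sub>k|\<^sup>2 / p\<^sub>k\<close> with \<open>p\<^sub>k = |b\<^sub>k|\<^sup>2\<close>. Hence
  \<open>1 / \<lambda>\<^sub>m\<^sub>i\<^sub>n\<close> is a supremum of convex functions of \<open>p\<close>. For small \<open>T\<close> a minimising \<open>c\<close> has no zero
  coefficient: \<open>n - 1\<close> frequencies have energy at least of order \<open>T\<^bsup>2n-3\<^esup>\<close>, but the Lagrange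
  weights, which annihilate all moments below \<open>n - 1\<close>, have energy \<open>O(T\<^bsup>2n-1\<^esup>)\<close>. The convexity is
  therefore strict, so all maximisers share the same \<open>p\<close> and differ by unimodular factors on
  the eigenvectors, which are exactly the orthogonal matrices commuting with \<open>A\<close>.
\<close>

subsection \<open>Energy of exponential sums\<close>

text \<open>The obstacle is uniformity: the threshold for \<open>T\<close> must not depend on
  \<open>b\<close>, although maximisers move with \<open>T\<close> and some weights
  \<open>p k\<close> could a priori degenerate. The remedy is to compare everything with the
  smallest weight \<open>p i\<close>. Testing with the Lagrange weights bounds
  \<open>\<mu> / p i\<close> by a constant times \<open>T^(2n-1)\<close>, and a minimiser has energy
  at most \<open>n * \<mu> / p i\<close> times its largest squared coefficient, so \<open>p\<close>
  drops out. A second constraint is reality. Only coefficient families symmetric under conjugation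
  of the spectrum come from real vectors \<open>x\<close>, so each test family has to be checked for
  this symmetry. Dividing by \<open>p k\<close> presupposes nonzero coordinates of \<open>b\<close>.
  A vanishing coordinate makes the Gramian singular, which positivity of \<open>gamma1\<close>
  excludes for maximisers. Finally, the minimising \<open>c\<close> at the mean of two weight
  families is a test family for both maximisers. A zero coefficient of \<open>c\<close> would give
  no information about the weights at that index, which is why nonvanishing is the crux.\<close>

definition exp_sum :: "'a set \<Rightarrow> ('a \<Rightarrow> complex) \<Rightarrow> ('a \<Rightarrow> complex) \<Rightarrow> real \<Rightarrow> complex" where
  "exp_sum I e c t = (\<Sum>k\<in>I. c k * exp (of_real t * e k))"

definition exp_energy :: "'a set \<Rightarrow> ('a \<Rightarrow> complex) \<Rightarrow> real \<Rightarrow> ('a \<Rightarrow> complex) \<Rightarrow> real" where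
  "exp_energy I e T c = integral {0..T} (\<lambda>t. (cmod (exp_sum I e c t))\<^sup>2)"

lemma continuous_on_exp_sum [continuous_intros]: "continuous_on X (exp_sum I e c)"
  unfolding exp_sum_def by (intro continuous_intros)

lemma norm_diff_squared_le:
  fixes a b :: "'a::real_normed_vector"
  shows "(norm (a - b))\<^sup>2 \<le> 2 * (norm a)\<^sup>2 + 2 * (norm b)\<^sup>2"
proof -
  have "(norm (a - b))\<^sup>2 \<le> (norm a + norm b)\<^sup>2"
    by (rule power_mono) (auto intro: norm_triangle_ineq4)
  moreover have "0 \<le> (norm a - norm b)\<^sup>2" by simp
  ultimately show ?thesis by (simp add: power2_eq_square algebra_simps)
qed

lemma exp_energy_nonneg: "0 \<le> exp_energy I e T c"
  unfolding exp_energy_def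
  by (rule integral_nonneg) (auto intro!: integrable_continuous_real continuous_intros)

section \<open>Lower energy bound: removing frequencies by shifts\<close>

lemma shifted_energy_le:
  assumes "0 \<le> s" "0 \<le> h"
  shows "integral {0..s} (\<lambda>t. (cmod (exp_sum I e c (t + h)))\<^sup>2) \<le> exp_energy I e (s + h) c"
proof -
  let ?g = "\<lambda>t. (cmod (exp_sum I e c t))\<^sup>2"
  have "integral {0..s} (?g \<circ> (\<lambda>t. t + h)) = integral {h..s+h} ?g"
    using integral_shift_real_ivl[of h h "s + h" ?g] by (simp add: o_def)
  also have "\<dots> \<le> integral {0..s+h} ?g"
    by (rule integral_subset_le)
       (use assms in \<open>auto intro!: integrable_continuous_real continuous_intros\<close>)
  finally show ?thesis by (simp add: exp_energy_def o_def)
qed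

text \<open>The shift operator \<open>f \<mapsto> f(\<cdot> + h) - exp (h e\<^sub>j) f\<close> removes the frequency \<open>e\<^sub>j\<close>.\<close>

lemma exp_sum_difference:
  assumes "finite J" "j \<notin> J"
  shows "exp_sum (insert j J) e c (t + h) - exp (of_real h * e j) * exp_sum (insert j J) e c t
       = exp_sum J e (\<lambda>k. c k * (exp (of_real h * e k) - exp (of_real h * e j))) t"
proof -
  have "exp_sum J e c (t + h) - exp (of_real h * e j) * exp_sum J e c t
      = exp_sum J e (\<lambda>k. c k * (exp (of_real h * e k) - exp (of_real h * e j))) t"
    unfolding exp_sum_def sum_distrib_left sum_subtractf[symmetric]
    by (rule sum.cong) (auto simp: algebra_simps exp_add)
  moreover have "exp (of_real (t + h) * e j) = exp (of_real h * e j) * exp (of_real t * e j)"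
    by (simp add: algebra_simps exp_add)
  ultimately show ?thesis
    using assms by (simp add: exp_sum_def algebra_simps)
qed

text \<open>The price of removing one frequency: the window shrinks by \<open>h\<close>, and the
  energy grows by at most 10 = 2 + 8, from \<open>|a - b|^2 \<le> 2|a|^2 + 2|b|^2\<close> with a
  multiplier of modulus at most 2.\<close>

lemma difference_energy_le:
  assumes "finite J" "j \<notin> J" "0 \<le> s" "0 \<le> h" and le2: "cmod (exp (of_real h * e j)) \<le> 2"
  shows "exp_energy J e s (\<lambda>k. c k * (exp (of_real h * e k) - exp (of_real h * e j)))
       \<le> 10 * exp_energy (insert j J) e (s + h) c"
proof -
  let ?f = "exp_sum (insert j J) e c" and ?a = "exp (of_real h * e j)"
  have ci: "continuous_on X (\<lambda>t. ?f (t + h))" for X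
    unfolding exp_sum_def by (intro continuous_intros)
  have "exp_energy J e s (\<lambda>k. c k * (exp (of_real h * e k) - exp (of_real h * e j)))
      = integral {0..s} (\<lambda>t. (cmod (?f (t + h) - ?a * ?f t))\<^sup>2)"
    unfolding exp_energy_def exp_sum_difference[OF assms(1,2)] by simp
  also have "\<dots> \<le> integral {0..s} (\<lambda>t. 2 * (cmod (?f (t + h)))\<^sup>2 + 8 * (cmod (?f t))\<^sup>2)"
  proof (rule integral_le)
    fix t
    have "(cmod ?a * cmod (?f t))\<^sup>2 \<le> (2 * cmod (?f t))\<^sup>2"
      by (intro power_mono mult_right_mono le2) auto
    then show "(cmod (?f (t + h) - ?a * ?f t))\<^sup>2 \<le> 2 * (cmod (?f (t + h)))\<^sup>2 + 8 * (cmod (?f t))\<^sup>2"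
      using norm_diff_squared_le[of "?f (t+h)" "?a * ?f t"] by (simp add: norm_mult power_mult_distrib)
  qed (auto intro!: integrable_continuous_real continuous_intros ci)
  also have "\<dots> = 2 * integral {0..s} (\<lambda>t. (cmod (?f (t + h)))\<^sup>2) + 8 * exp_energy (insert j J) e s c"
    unfolding exp_energy_def
    by (subst integral_add) (auto intro!: integrable_continuous_real continuous_intros ci)
  also have "\<dots> \<le> 2 * exp_energy (insert j J) e (s + h) c + 8 * exp_energy (insert j J) e (s + h) c"
  proof -
    have "exp_energy (insert j J) e s c \<le> exp_energy (insert j J) e (s + h) c"
      unfolding exp_energy_def
      by (rule integral_subset_le)
         (use assms in \<open>auto intro!: integrable_continuous_real continuous_intros\<close>)
    then show ?thesis using shifted_energy_le[OF assms(3,4), of "insert j J" e c] by linarith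
  qed
  finally show ?thesis by simp
qed

text \<open>Each removed frequency costs a factor 10 and a further length \<open>h\<close> of the
  window. The induction generalises \<open>c\<close> because its hypothesis is applied to
  coefficients already multiplied by the factor for \<open>j\<close>.\<close>

lemma isolate_coefficient:
  assumes "finite J" "k \<notin> J" "0 \<le> h" and "\<And>j. j \<in> J \<Longrightarrow> cmod (exp (of_real h * e j)) \<le> 2"
  shows "exp_energy {k} e h (\<lambda>l. c l * (\<Prod>j\<in>J. exp (of_real h * e k) - exp (of_real h * e j)))
      \<le> 10 ^ card J * exp_energy (insert k J) e (h * (1 + real (card J))) c"
  using assms
proof (induction J arbitrary: c rule: finite_induct)
  case empty
  then show ?case by simp
next
  case (insert j J)
  let ?c = "\<lambda>l. c l * (exp (of_real h * e l) - exp (of_real h * e j))"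
  have "exp_energy {k} e h (\<lambda>l. c l * (\<Prod>j\<in>insert j J. exp (of_real h * e k) - exp (of_real h * e j)))
      = exp_energy {k} e h (\<lambda>l. ?c l * (\<Prod>j\<in>J. exp (of_real h * e k) - exp (of_real h * e j)))"
    unfolding exp_energy_def exp_sum_def using insert.hyps by (simp add: algebra_simps)
  also have "\<dots> \<le> 10 ^ card J * exp_energy (insert k J) e (h * (1 + real (card J))) ?c"
    using insert.prems by (intro insert.IH) auto
  also have "\<dots> \<le> 10 ^ card J * (10 * exp_energy (insert j (insert k J)) e (h * (1 + real (card J)) + h) c)"
    using insert.prems insert.hyps by (intro mult_left_mono difference_energy_le) auto
  also have "h * (1 + real (card J)) + h = h * (1 + real (card (insert j J)))"
    using insert.hyps by (simp add: algebra_simps)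
  finally show ?case using insert.hyps by (simp add: insert_commute)
qed

lemma exp_difference_lower:
  fixes a b :: complex
  assumes "a \<noteq> b"
  shows "\<forall>\<^sub>F h in at_right 0. cmod (a - b) / 2 * h \<le> cmod (exp (of_real h * a) - exp (of_real h * b))"
proof -
  have "((\<lambda>z. exp (z * a) - exp (z * b)) has_field_derivative (a - b)) (at 0)"
    by (auto intro!: derivative_eq_intros)
  then have "((\<lambda>z. (exp (z * a) - exp (z * b)) / z) \<longlongrightarrow> a - b) (at 0)"
    by (simp add: has_field_derivative_iff)
  moreover have "filterlim complex_of_real (at 0) (at_right 0)"
    unfolding filterlim_at
    by (auto intro!: tendsto_eq_intros simp: eventually_at_right_less eventually_at_filter)
  ultimately have "((\<lambda>h. (exp (of_real h * a) - exp (of_real h * b)) / of_real h) \<longlongrightarrow> a - b) (at_right 0)"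
    by (rule filterlim_compose)
  then have "((\<lambda>h. cmod ((exp (of_real h * a) - exp (of_real h * b)) / of_real h)) \<longlongrightarrow> cmod (a - b)) (at_right 0)"
    by (rule tendsto_norm)
  then have "\<forall>\<^sub>F h in at_right 0. cmod (a - b) / 2 < cmod ((exp (of_real h * a) - exp (of_real h * b)) / of_real h)"
    by (rule order_tendstoD) (use assms in simp)
  then show ?thesis
    using eventually_at_right_less[of "0::real"]
    by eventually_elim (simp add: norm_divide field_simps)
qed

lemma norm_exp_near_one:
  fixes a :: complex
  assumes "0 < \<epsilon>"
  shows "\<forall>\<^sub>F h in at_right 0. \<bar>cmod (exp (of_real h * a)) - 1\<bar> < \<epsilon>"
proof -
  have "((\<lambda>h. cmod (exp (of_real h * a))) \<longlongrightarrow> cmod (exp (of_real 0 * a))) (at_right 0)"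
    by (intro tendsto_intros)
  then show ?thesis using assms by (simp add: tendsto_iff dist_real_def)
qed

text \<open>Isolating \<open>e k\<close> multiplies its coefficient by \<open>card J\<close> factors
  of order \<open>T\<close>. Squaring gives \<open>T ^ (2 * card J)\<close>, and integration over a
  window of order \<open>T\<close> gives the last power.\<close>

lemma exp_energy_lower_bound:
  assumes "finite J" "k \<notin> J" "inj_on e (insert k J)"
  shows "\<exists>K>0. \<forall>\<^sub>F T in at_right 0. \<forall>c. K * T ^ (2 * card J + 1) * (cmod (c k))\<^sup>2 \<le> exp_energy (insert k J) e T c"
proof -
  define m where "m = 1 + real (card J)"
  define d where "d = (\<Prod>j\<in>J. cmod (e k - e j) / 2)"
  have m: "m > 0" by (simp add: m_def)
  have ne: "e k \<noteq> e j" if "j \<in> J" for j using assms that by (auto simp: inj_on_def)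
  have d: "d > 0" unfolding d_def by (rule prod_pos) (use ne in simp)
  \<comment> \<open>\<open>d\<close> collects the bounds of \<open>exp_difference_lower\<close>, the
    4 comes from \<open>cmod (exp (t * e k)) \<ge> 1/2\<close>, the power of 10 from
    \<open>isolate_coefficient\<close>, and the power of \<open>m\<close> from expressing
    \<open>h\<close> through \<open>T\<close>.\<close>
  define K where "K = (d\<^sup>2 / 4) / 10 ^ card J / m ^ (2 * card J + 1)"
  have K: "K > 0" using d m by (simp add: K_def)
  have "\<forall>\<^sub>F h in at_right 0. (\<forall>j\<in>J. cmod (e k - e j) / 2 * h \<le> cmod (exp (of_real h * e k) - exp (of_real h * e j)))"
    using ne by (intro eventually_ball_finite[OF assms(1)]) (blast intro: exp_difference_lower)
  moreover have "\<forall>\<^sub>F h in at_right 0. (\<forall>j\<in>J. \<bar>cmod (exp (of_real h * e j)) - 1\<bar> < 1/2)"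
    by (intro eventually_ball_finite[OF assms(1)] ballI norm_exp_near_one) simp
  moreover have "\<forall>\<^sub>F h in at_right 0. \<bar>cmod (exp (of_real h * e k)) - 1\<bar> < 1/2"
    by (rule norm_exp_near_one) simp
  moreover have "\<forall>\<^sub>F h in at_right (0::real). 0 < h" by (rule eventually_at_right_less)
  ultimately have ev: "\<forall>\<^sub>F h in at_right 0. 0 < h \<and>
      (\<forall>j\<in>J. cmod (e k - e j) / 2 * h \<le> cmod (exp (of_real h * e k) - exp (of_real h * e j))) \<and>
      (\<forall>j\<in>J. \<bar>cmod (exp (of_real h * e j)) - 1\<bar> < 1/2)" (is "eventually ?P _")
    by eventually_elim auto
  then obtain b where b: "b > 0" "\<And>h. 0 < h \<Longrightarrow> h < b \<Longrightarrow> ?P h"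
    unfolding eventually_at_right_field by auto
  \<comment> \<open>The final integrand needs this bound at every \<open>t\<close> of the window,
    not only at \<open>h\<close>, so it is extracted for all arguments below
    \<open>b'\<close>.\<close>
  obtain b' where b': "b' > 0" "\<And>h. 0 < h \<Longrightarrow> h < b' \<Longrightarrow> \<bar>cmod (exp (of_real h * e k)) - 1\<bar> < 1/2"
    using norm_exp_near_one[of "1/2" "e k"] unfolding eventually_at_right_field by auto
  have "K * T ^ (2 * card J + 1) * (cmod (c k))\<^sup>2 \<le> exp_energy (insert k J) e T c"
    if T: "0 < T" "T < min b b'" for T c
  proof -
    \<comment> \<open>\<open>m = card J + 1\<close> windows of length \<open>h\<close> fill the
      horizon: one for each removed frequency and one for the final integration.\<close>
    define h where "h = T / m"
    have h: "0 < h" "h < b" "h < b'" "h * m = T"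
    proof -
      have "h \<le> T" using T m by (simp add: h_def m_def divide_le_eq)
      then show "0 < h" "h < b" "h < b'" "h * m = T" using T m by (auto simp: h_def)
    qed
    let ?\<Delta> = "\<Prod>j\<in>J. exp (of_real h * e k) - exp (of_real h * e j)"
    have "d * h ^ card J = (\<Prod>j\<in>J. cmod (e k - e j) / 2 * h)"
      by (simp add: d_def prod.distrib prod_dividef power_divide)
    also have "\<dots> \<le> cmod ?\<Delta>"
      unfolding prod_norm[symmetric] by (rule prod_mono) (use b(2)[OF h(1,2)] h in auto)
    finally have \<Delta>: "d * h ^ card J \<le> cmod ?\<Delta>" .
    have "(d * h ^ card J)\<^sup>2 * (cmod (c k))\<^sup>2 / 4 * h
        = integral {0..h} (\<lambda>t. (d * h ^ card J)\<^sup>2 * (cmod (c k))\<^sup>2 / 4)"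
      using h by simp
    also have "\<dots> \<le> exp_energy {k} e h (\<lambda>l. c l * ?\<Delta>)"
      unfolding exp_energy_def
    proof (rule integral_le)
      fix t assume t: "t \<in> {0..h}"
      have t2: "1/2 \<le> cmod (exp (of_real t * e k))"
      proof (cases "t = 0")
        case False
        then have "\<bar>cmod (exp (of_real t * e k)) - 1\<bar> < 1/2" using b'(2)[of t] t h by auto
        then show ?thesis unfolding abs_less_iff by linarith
      qed simp
      have "(d * h ^ card J) * cmod (c k) * (1/2) \<le> cmod ?\<Delta> * cmod (c k) * cmod (exp (of_real t * e k))"
        using d h by (intro mult_mono \<Delta> t2) auto
      then have "((d * h ^ card J) * cmod (c k) * (1/2))\<^sup>2 \<le> (cmod ?\<Delta> * cmod (c k) * cmod (exp (of_real t * e k)))\<^sup>2"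
        using d h by (intro power_mono) auto
      then show "(d * h ^ card J)\<^sup>2 * (cmod (c k))\<^sup>2 / 4 \<le> (cmod (exp_sum {k} e (\<lambda>l. c l * ?\<Delta>) t))\<^sup>2"
        by (simp add: exp_sum_def norm_mult power_mult_distrib mult_ac power_divide)
    qed (auto intro!: integrable_continuous_real continuous_intros)
    also have "\<dots> \<le> 10 ^ card J * exp_energy (insert k J) e (h * (1 + real (card J))) c"
    proof (rule isolate_coefficient[OF assms(1,2)])
      show "cmod (exp (of_real h * e j)) \<le> 2" if "j \<in> J" for j
      proof -
        have "\<bar>cmod (exp (of_real h * e j)) - 1\<bar> < 1/2" using b(2)[OF h(1,2)] that by blast
        then show ?thesis unfolding abs_less_iff by linarith
      qed
    qed (use h in auto)
    finally have "(d * h ^ card J)\<^sup>2 * (cmod (c k))\<^sup>2 / 4 * h \<le> 10 ^ card J * exp_energy (insert k J) e T c"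
      using h(4) by (simp add: m_def)
    moreover have "K * T ^ (2 * card J + 1) = (d * h ^ card J)\<^sup>2 / 4 * h / 10 ^ card J"
      unfolding K_def h(4)[symmetric] using m
      by (simp add: power_mult_distrib field_simps power_mult[symmetric] mult.commute[of 2])
    then have "K * T ^ (2 * card J + 1) * (cmod (c k))\<^sup>2
        = ((d * h ^ card J)\<^sup>2 * (cmod (c k))\<^sup>2 / 4 * h) / 10 ^ card J" by simp
    ultimately show ?thesis by (simp add: divide_le_eq mult.commute)
  qed
  then show ?thesis
    using K b(1) b'(1) unfolding eventually_at_right_field
    by (intro exI[of _ K]) (auto intro!: exI[of _ "min b b'"])
qed

section \<open>Lagrange weights, upper energy bound and nonvanishing coefficients\<close>

definition lagrange_weight :: "'a set \<Rightarrow> ('a \<Rightarrow> complex) \<Rightarrow> 'a \<Rightarrow> complex" where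
  "lagrange_weight I e k = (\<Prod>j\<in>I - {k}. inverse (e k - e j))"

lemma lagrange_weight_nonzero:
  assumes "finite I" "inj_on e I" "k \<in> I"
  shows "lagrange_weight I e k \<noteq> 0"
  using assms by (auto simp: lagrange_weight_def inj_on_def)

text \<open>These are the barycentric weights, so the sum is the divided difference of
  \<open>x ^ m\<close> at the nodes: the top coefficient of its Lagrange interpolant. The
  interpolant is \<open>x ^ m\<close> itself, of degree below \<open>card I - 1\<close>.\<close>

lemma lagrange_weight_moment:
  assumes "finite I" "inj_on e I" "Suc m < card I"
  shows "(\<Sum>k\<in>I. lagrange_weight I e k * e k ^ m) = 0"
proof -
  define n where "n = card I - 1"
  have n: "m < n" "card I = Suc n" using assms(3) by (auto simp: n_def)
  define L where "L = (\<lambda>k. \<Prod>j\<in>I - {k}. [:- e j, 1:])"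
  \<comment> \<open>The Lagrange interpolant of \<open>x ^ m\<close>. Each \<open>L k\<close> is
    monic of degree \<open>n\<close>, so the coefficient of \<open>P\<close> at \<open>n\<close> is
    exactly the moment.\<close>
  define P where "P = (\<Sum>k\<in>I. smult (lagrange_weight I e k * e k ^ m) (L k))"
  have degL: "degree (L k) = n" "coeff (L k) n = 1" if "k \<in> I" for k
  proof -
    show d: "degree (L k) = n"
      using that assms(1) n unfolding L_def by (subst degree_prod_eq_sum_degree) auto
    have "lead_coeff (L k) = 1"
      unfolding L_def by (simp add: lead_coeff_prod)
    then show "coeff (L k) n = 1" using d by simp
  qed
  have "P = monom 1 m"
  proof (rule poly_eqI_degree[of "e ` I"])
    show "card (e ` I) > degree P"
    proof -
      have "degree P \<le> n" unfolding P_def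
        using degL assms(1) by (intro degree_sum_le) (auto intro: order_trans[OF degree_smult_le])
      then show ?thesis using n assms(2) by (simp add: card_image)
    qed
    show "card (e ` I) > degree (monom (1::complex) m)"
      using n assms(2) by (simp add: card_image degree_monom_eq)
    fix x assume "x \<in> e ` I"
    then obtain l where l: "l \<in> I" "x = e l" by auto
    have L0: "poly (L k) (e l) = 0" if "k \<in> I" "k \<noteq> l" for k
      using that l assms(1) by (auto simp: L_def poly_prod)
    have "poly P x = (\<Sum>k\<in>I. lagrange_weight I e k * e k ^ m * poly (L k) (e l))"
      by (simp add: P_def poly_sum l)
    also have "\<dots> = lagrange_weight I e l * e l ^ m * poly (L l) (e l)"
      using l assms(1) L0 by (subst sum.remove[OF _ l(1)]) (auto intro!: sum.neutral)
    also have "lagrange_weight I e l * poly (L l) (e l) = 1"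
      using lagrange_weight_nonzero[OF assms(1,2) l(1)]
      unfolding lagrange_weight_def L_def poly_prod
      by (simp add: prod_inversef[unfolded o_def])
    then have "lagrange_weight I e l * e l ^ m * poly (L l) (e l) = e l ^ m"
      by (metis mult.assoc mult.commute mult_1)
    finally show "poly P x = poly (monom 1 m) x" using l by (simp add: poly_monom)
  qed
  then have "coeff P n = 0" using n by simp
  then show ?thesis using degL by (simp add: P_def coeff_sum)
qed

lemma exp_taylor_remainder:
  fixes z :: complex
  shows "cmod (exp z - (\<Sum>j<N. z ^ j / fact j)) \<le> exp (cmod z) * cmod z ^ N"
proof (cases N)
  case 0
  then show ?thesis using complex_Re_le_cmod[of z] by simp
next
  case (Suc m)
  have "cmod (exp z - (\<Sum>j\<le>m. z ^ j / fact j)) \<le> exp (cmod z) * cmod z ^ Suc m / fact m"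
    by (rule Taylor_exp_field)
  also have "\<dots> \<le> exp (cmod z) * cmod z ^ Suc m"
    by (simp add: divide_le_eq mult_right_le_one_le[of _ 1] mult_le_cancel_left1)
       (meson fact_ge_1 mult_nonneg_nonneg exp_ge_zero norm_ge_zero zero_le_power not_le)
  finally show ?thesis by (simp add: Suc lessThan_Suc_atMost)
qed

text \<open>Vanishing moments cancel the Taylor terms of degree below \<open>N\<close>, leaving a
  sum of modulus at most \<open>C * t ^ N\<close>. The restriction \<open>T \<le> 1\<close> makes
  the exponential factor in the remainder independent of \<open>T\<close>.\<close>

lemma exp_energy_upper_bound:
  assumes "finite I" and moments: "\<And>m. m < N \<Longrightarrow> (\<Sum>k\<in>I. w k * e k ^ m) = 0"
  shows "\<exists>C. \<forall>T. 0 < T \<and> T \<le> 1 \<longrightarrow> exp_energy I e T w \<le> C * T ^ (2 * N + 1)"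
proof -
  define C where "C = (\<Sum>k\<in>I. cmod (w k) * (exp (cmod (e k)) * cmod (e k) ^ N))"
  have C: "C \<ge> 0" unfolding C_def by (intro sum_nonneg) auto
  have bound: "cmod (exp_sum I e w t) \<le> C * t ^ N" if t: "0 \<le> t" "t \<le> 1" for t
  proof -
    have "(\<Sum>k\<in>I. w k * (\<Sum>j<N. (of_real t * e k) ^ j / fact j))
        = (\<Sum>j<N. of_real t ^ j / fact j * (\<Sum>k\<in>I. w k * e k ^ j))"
      unfolding sum_distrib_left
      by (subst sum.swap) (auto intro!: sum.cong simp: power_mult_distrib)
    also have "\<dots> = 0" by (simp add: moments)
    finally have "exp_sum I e w t
        = (\<Sum>k\<in>I. w k * (exp (of_real t * e k) - (\<Sum>j<N. (of_real t * e k) ^ j / fact j)))"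
      by (simp add: exp_sum_def right_diff_distrib sum_subtractf)
    also have "cmod \<dots> \<le> (\<Sum>k\<in>I. cmod (w k) * (exp (cmod (e k)) * cmod (e k) ^ N) * t ^ N)"
    proof (rule sum_norm_le)
      fix k
      have "cmod (exp (of_real t * e k) - (\<Sum>j<N. (of_real t * e k) ^ j / fact j))
          \<le> exp (t * cmod (e k)) * (t * cmod (e k)) ^ N"
        using exp_taylor_remainder[of "of_real t * e k" N] t by (simp add: norm_mult)
      also have "\<dots> \<le> exp (cmod (e k)) * cmod (e k) ^ N * t ^ N"
      proof -
        have "exp (t * cmod (e k)) \<le> exp (cmod (e k))" using t by (simp add: mult_left_le_one_le)
        from mult_right_mono[OF this, of "(t * cmod (e k)) ^ N"] show ?thesis
          using t by (simp add: power_mult_distrib mult_ac)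
      qed
      finally show "cmod (w k * (exp (of_real t * e k) - (\<Sum>j<N. (of_real t * e k) ^ j / fact j)))
          \<le> cmod (w k) * (exp (cmod (e k)) * cmod (e k) ^ N) * t ^ N"
        by (simp add: norm_mult mult.assoc mult_left_mono)
    qed
    finally show ?thesis by (simp add: C_def sum_distrib_right)
  qed
  have "exp_energy I e T w \<le> C\<^sup>2 * T ^ (2 * N + 1)" if T: "0 < T" "T \<le> 1" for T
  proof -
    have "exp_energy I e T w \<le> integral {0..T} (\<lambda>t. (C * T ^ N)\<^sup>2)"
      unfolding exp_energy_def
    proof (rule integral_le)
      fix t assume t: "t \<in> {0..T}"
      have "cmod (exp_sum I e w t) \<le> C * t ^ N" using t T by (intro bound) auto
      also have "\<dots> \<le> C * T ^ N" using t C by (intro mult_left_mono power_mono) auto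
      finally show "(cmod (exp_sum I e w t))\<^sup>2 \<le> (C * T ^ N)\<^sup>2" by (intro power_mono) auto
    qed (auto intro!: integrable_continuous_real continuous_intros)
    also have "\<dots> = C\<^sup>2 * T ^ (2 * N + 1)"
      using T by (simp add: power_mult_distrib power_mult[symmetric] mult_ac)
    finally show ?thesis .
  qed
  then show ?thesis by blast
qed

lemma exp_energy_drop_zero:
  assumes "finite I" "l \<in> I" "c l = 0"
  shows "exp_energy I e T c = exp_energy (I - {l}) e T c"
  unfolding exp_energy_def exp_sum_def using assms by (simp add: sum.remove[OF assms(1,2)])

text \<open>With a vanishing coefficient, \<open>c\<close> has energy at least of order \<open>T\<^bsup>2n-3\<^esup>\<close>,
  whereas the Lagrange weights have energy of order \<open>T\<^bsup>2n-1\<^esup>\<close>.\<close>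

lemma minimiser_coefficient_nonzero:
  assumes "finite I" "inj_on e I"
  shows "\<forall>\<^sub>F T in at_right 0. \<forall>p \<mu> c.
      (\<forall>k\<in>I. 0 < p k) \<longrightarrow>
      \<mu> * (\<Sum>k\<in>I. (cmod (lagrange_weight I e k))\<^sup>2 / p k) \<le> exp_energy I e T (lagrange_weight I e) \<longrightarrow>
      exp_energy I e T c = \<mu> * (\<Sum>k\<in>I. (cmod (c k))\<^sup>2 / p k) \<longrightarrow>
      (\<exists>k\<in>I. c k \<noteq> 0) \<longrightarrow> (\<forall>k\<in>I. c k \<noteq> 0)"
proof (cases "card I \<le> 1")
  case True
  then have "I = {} \<or> (\<exists>k. I = {k})"
    using assms(1) by (metis card_0_eq card_1_singletonE le_antisym less_one not_le)
  then show ?thesis by auto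
next
  case False
  \<comment> \<open>\<open>N = n - 2\<close> counts the frequencies besides \<open>k\<close> that
    remain once \<open>l\<close> is dropped; the Lagrange weights have \<open>N + 1\<close>
    vanishing moments.\<close>
  define N where "N = card I - 2"
  have cardI: "card I = N + 2" using False by (simp add: N_def)
  have I: "I \<noteq> {}" using False by auto
  let ?w = "lagrange_weight I e"
  obtain C where C: "\<And>T. 0 < T \<Longrightarrow> T \<le> 1 \<Longrightarrow> exp_energy I e T ?w \<le> C * T ^ (2 * (N + 1) + 1)"
    using exp_energy_upper_bound[OF assms(1), of "N + 1" ?w e] lagrange_weight_moment[OF assms] cardI
    by auto
  define \<omega> where "\<omega> = Min ((\<lambda>k. (cmod (?w k))\<^sup>2) ` I)"
  have \<omega>: "\<omega> > 0" "\<And>k. k \<in> I \<Longrightarrow> \<omega> \<le> (cmod (?w k))\<^sup>2"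
    unfolding \<omega>_def using assms I lagrange_weight_nonzero[OF assms] by (auto simp: Min_gr_iff)
  have "\<forall>\<^sub>F T in at_right 0. \<forall>c. c k \<noteq> 0 \<longrightarrow>
      card I * (C * T ^ (2 * (N + 1) + 1)) * (cmod (c k))\<^sup>2 < \<omega> * exp_energy (I - {l}) e T c"
    if "l \<in> I" "k \<in> I - {l}" for l k
  proof -
    have "insert k (I - {l} - {k}) = I - {l}" "card (I - {l} - {k}) = N"
      using that assms(1) cardI by auto
    then obtain K where K: "K > 0"
        "\<forall>\<^sub>F T in at_right 0. \<forall>c. K * T ^ (2 * N + 1) * (cmod (c k))\<^sup>2 \<le> exp_energy (I - {l}) e T c"
      using exp_energy_lower_bound[of "I - {l} - {k}" k e] assms
      by (auto intro: inj_on_subset)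
    \<comment> \<open>The exponents of the upper and the lower bound differ by 2, so their quotient
      is a constant times \<open>T^2\<close>.\<close>
    have "((\<lambda>T. real (card I) * C * T\<^sup>2) \<longlongrightarrow> real (card I) * C * 0\<^sup>2) (at_right 0)"
      by (intro tendsto_intros)
    then have "\<forall>\<^sub>F T in at_right 0. real (card I) * C * T\<^sup>2 < \<omega> * K"
      by (rule order_tendstoD(2)) (use K(1) \<omega>(1) in simp)
    then show ?thesis
      using K(2) eventually_at_right_less[of "0::real"]
    proof eventually_elim
      case (elim T)
      show ?case
      proof (intro allI impI)
        fix c :: "'a \<Rightarrow> complex"
        assume "c k \<noteq> 0"
        then have "(real (card I) * C * T\<^sup>2) * (T ^ (2 * N + 1) * (cmod (c k))\<^sup>2)
            < (\<omega> * K) * (T ^ (2 * N + 1) * (cmod (c k))\<^sup>2)"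
          using elim by (intro mult_strict_right_mono) auto
        also have "\<dots> = \<omega> * (K * T ^ (2 * N + 1) * (cmod (c k))\<^sup>2)" by (simp add: mult_ac)
        also have "\<dots> \<le> \<omega> * exp_energy (I - {l}) e T c"
          using elim \<omega>(1) by (intro mult_left_mono) auto
        finally show "card I * (C * T ^ (2 * (N + 1) + 1)) * (cmod (c k))\<^sup>2 < \<omega> * exp_energy (I - {l}) e T c"
          by (simp add: power2_eq_square mult_ac)
      qed
    qed
  qed
  then have gap: "\<forall>\<^sub>F T in at_right 0. \<forall>l\<in>I. \<forall>k\<in>I - {l}. \<forall>c. c k \<noteq> 0 \<longrightarrow>
      card I * (C * T ^ (2 * (N + 1) + 1)) * (cmod (c k))\<^sup>2 < \<omega> * exp_energy (I - {l}) e T c"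
    by (intro eventually_ball_finite ballI) (use assms(1) in auto)
  have le1: "\<forall>\<^sub>F T in at_right (0::real). T \<le> 1"
    unfolding eventually_at_right_field by (auto intro!: exI[of _ 1])
  show ?thesis
    using gap le1 eventually_at_right_less[of "0::real"]
  proof eventually_elim
    case (elim T)
    show ?case
    proof (intro allI impI ballI notI)
      fix p :: "'a \<Rightarrow> real" and \<mu> c l
      assume p: "\<forall>k\<in>I. 0 < p k"
        and test: "\<mu> * (\<Sum>k\<in>I. (cmod (?w k))\<^sup>2 / p k) \<le> exp_energy I e T ?w"
        and eq: "exp_energy I e T c = \<mu> * (\<Sum>k\<in>I. (cmod (c k))\<^sup>2 / p k)"
        and ex: "\<exists>k\<in>I. c k \<noteq> 0" and l: "l \<in> I" and cl: "c l = 0"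
      \<comment> \<open>The smallest weight \<open>p i\<close> and the largest coefficient
        \<open>c k\<close>: the factor \<open>1 / p i\<close> bounds the weighted sum of
        \<open>c\<close> from above and that of the Lagrange weights from below, hence
        cancels.\<close>
      define i where "i = arg_min_on p I"
      define k where "k = arg_min_on (\<lambda>j. - cmod (c j)) I"
      have i: "i \<in> I" "\<And>j. j \<in> I \<Longrightarrow> p i \<le> p j"
        unfolding i_def using arg_min_if_finite(1)[OF assms(1) I] arg_min_least[OF assms(1) I] by auto
      have k: "k \<in> I" "\<And>j. j \<in> I \<Longrightarrow> cmod (c j) \<le> cmod (c k)"
        unfolding k_def using arg_min_if_finite(1)[OF assms(1) I]
          arg_min_least[OF assms(1) I, where f = "\<lambda>j. - cmod (c j)"] by auto
      have ck: "cmod (c k) > 0" proof -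
        obtain j where "j \<in> I" "c j \<noteq> 0" using ex by blast
        then show ?thesis using k(2)[of j] by (auto intro: less_le_trans[of 0 "cmod (c j)"])
      qed
      then have kl: "k \<in> I - {l}" using k cl by auto
      have pi: "p i > 0" using p i by auto
      have pos: "(\<Sum>k\<in>I. (cmod (c k))\<^sup>2 / p k) > 0"
        using p k(1) ck assms(1) by (intro sum_pos2[of _ k]) (auto intro: less_imp_le)
      have \<mu>: "\<mu> \<ge> 0"
        using eq pos exp_energy_nonneg[of I e T c] by (metis mult_neg_pos not_le)
      have "(\<Sum>j\<in>I. (cmod (c j))\<^sup>2 / p j) \<le> (\<Sum>j\<in>I. (cmod (c k))\<^sup>2 / p i)"
        using k i p pi by (intro sum_mono frac_le) (auto intro: power_mono)
      then have A: "exp_energy I e T c \<le> \<mu> * (card I * ((cmod (c k))\<^sup>2 / p i))"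
        using \<mu> unfolding eq by (intro mult_left_mono) auto
      have "\<mu> * (\<omega> / p i) \<le> \<mu> * (\<Sum>k\<in>I. (cmod (?w k))\<^sup>2 / p k)"
      proof (rule mult_left_mono[OF _ \<mu>])
        have "\<omega> / p i \<le> (cmod (?w i))\<^sup>2 / p i" using \<omega>(2)[OF i(1)] pi by (simp add: divide_right_mono)
        also have "\<dots> \<le> (\<Sum>k\<in>I. (cmod (?w k))\<^sup>2 / p k)"
          using p by (intro member_le_sum[OF i(1)]) (auto simp: assms(1) less_imp_le)
        finally show "\<omega> / p i \<le> (\<Sum>k\<in>I. (cmod (?w k))\<^sup>2 / p k)" .
      qed
      also have "\<dots> \<le> C * T ^ (2 * (N + 1) + 1)"
        using test C[of T] elim by linarith
      finally have B: "\<mu> * (\<omega> / p i) \<le> C * T ^ (2 * (N + 1) + 1)" .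
      have "\<omega> * exp_energy I e T c \<le> \<omega> * (\<mu> * (card I * ((cmod (c k))\<^sup>2 / p i)))"
        using A \<omega>(1) by (intro mult_left_mono) auto
      also have "\<dots> = card I * (\<mu> * (\<omega> / p i)) * (cmod (c k))\<^sup>2" by (simp add: mult_ac)
      also have "\<dots> \<le> card I * (C * T ^ (2 * (N + 1) + 1)) * (cmod (c k))\<^sup>2"
        using B by (intro mult_right_mono mult_left_mono) auto
      also have "\<dots> < \<omega> * exp_energy (I - {l}) e T c"
        using elim(1) l kl ck by auto
      finally show False using exp_energy_drop_zero[of I l c e T] assms(1) l cl by simp
    qed
  qed
qed

subsection \<open>Characteristic polynomials and Rayleigh quotients\<close>

lemma mat_mult_vector: "mat z *v v = z *s (v :: 'a::comm_semiring_1^'n)"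
  by (simp add: matrix_vector_mult_def mat_def vec_eq_iff vector_scalar_mult_def if_distrib[of "\<lambda>a. a * _"] cong: if_cong)

lemma eigenvalues_eq_charpoly_roots:
  fixes M :: "'a::field^'n^'n"
  shows "eigenvalues M = {z. poly (charpoly M) z = 0}"
proof -
  have det_eq: "poly (charpoly M) z = det (mat z - M)" for z
    unfolding charpoly_def det_def
    by (simp add: poly_sum poly_prod mat_def map_matrix_def if_distrib[of "\<lambda>p. poly p z"]
        of_int_poly cong: if_cong)
  have "(\<exists>v. v \<noteq> 0 \<and> M *v v = z *s v) \<longleftrightarrow> det (mat z - M) = 0" for z
  proof -
    have eq: "(mat z - M) *v v = z *s v - M *v v" for v
      by (simp add: matrix_vector_mult_diff_rdistrib mat_mult_vector)
    have "det (mat z - M) \<noteq> 0 \<longleftrightarrow> (\<forall>v. (mat z - M) *v v = 0 \<longrightarrow> v = 0)"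
      by (simp add: invertible_det_nz[symmetric] invertible_left_inverse matrix_left_invertible_ker)
    then show ?thesis unfolding eq by (metis right_minus_eq)
  qed
  then show ?thesis by (simp add: eigenvalues_def det_eq)
qed

text \<open>Only the identity permutation picks all diagonal entries, and these are the only ones of
  degree 1.\<close>

lemma degree_charpoly:
  fixes M :: "'a::field^'n^'n"
  shows "degree (charpoly M) = CARD('n)"
proof -
  define N where "N = mat [:0, 1:] - map_matrix (\<lambda>a. [:a:]) M"
  define t where "t p = of_int (sign p) * (\<Prod>i\<in>UNIV. N $ i $ p i)" for p
  have diag: "N $ i $ i = [:- (M $ i $ i), 1:]" and off: "i \<noteq> j \<Longrightarrow> N $ i $ j = [:- (M $ i $ j):]" for i j
    by (simp_all add: N_def mat_def map_matrix_def)
  have idt: "degree (t id) = CARD('n)"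
    by (simp add: t_def diag degree_prod_eq_sum_degree)
  have lt: "degree (t p) < CARD('n)" if nid: "p \<noteq> id" for p
  proof -
    obtain i where i: "p i \<noteq> i" using nid by (auto simp: fun_eq_iff)
    have "degree (t p) \<le> degree (of_int (sign p) :: 'a poly) + degree (\<Prod>i\<in>UNIV. N $ i $ p i)"
      unfolding t_def by (rule degree_mult_le)
    also have "\<dots> \<le> (\<Sum>i\<in>UNIV. degree (N $ i $ p i))"
      using degree_prod_sum_le[of UNIV "\<lambda>i. N $ i $ p i"] by (simp add: o_def)
    also have "\<dots> < (\<Sum>i\<in>(UNIV::'n set). 1)"
    proof (rule sum_strict_mono_ex1)
      show "\<forall>x\<in>UNIV. degree (N $ x $ p x) \<le> 1"
      proof
        fix x show "degree (N $ x $ p x) \<le> 1"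
          by (cases "p x = x") (use diag[of x] off[of x "p x"] in auto)
      qed
      show "\<exists>a\<in>UNIV. degree (N $ a $ p a) < 1"
        using off[of i "p i"] i by (intro bexI[of _ i]) auto
    qed auto
    finally show ?thesis by simp
  qed
  have "charpoly M = t id + (\<Sum>p\<in>{p. p permutes UNIV} - {id}. t p)"
    unfolding charpoly_def N_def[symmetric] det_def t_def[symmetric]
    by (rule sum.remove) (auto simp: finite_permutations permutes_id)
  moreover have "degree (\<Sum>p\<in>{p. p permutes UNIV} - {id}. t p) < CARD('n)"
    by (rule degree_sum_less) (auto simp: lt)
  ultimately show ?thesis using idt by (simp add: degree_add_eq_left)
qed

text \<open>The multiplicities of the complex roots of the characteristic polynomial add up to the
  dimension, and each of them is 1.\<close>

lemma card_complex_spectrum: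
  fixes A :: "real^'n^'n"
  assumes "simple_spectrum A"
  shows "finite (complex_spectrum A)" "card (complex_spectrum A) = CARD('n)"
proof -
  let ?p = "charpoly (map_matrix complex_of_real A)"
  have S: "complex_spectrum A = {z. poly ?p z = 0}"
    by (simp add: complex_spectrum_def eigenvalues_eq_charpoly_roots)
  have p0: "?p \<noteq> 0" using degree_charpoly[of "map_matrix complex_of_real A"] by auto
  show fin: "finite (complex_spectrum A)" unfolding S by (rule poly_roots_finite[OF p0])
  have "CARD('n) = size (proots ?p)" by (simp add: size_proots_complex degree_charpoly)
  also have "\<dots> = (\<Sum>z\<in>complex_spectrum A. Polynomial.order z ?p)"
    using p0 by (simp add: size_multiset_overloaded_eq S)
  also have "\<dots> = card (complex_spectrum A)"
    using assms by (simp add: simple_spectrum_def)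
  finally show "card (complex_spectrum A) = CARD('n)" ..
qed

text \<open>Along the line \<open>y + s * H y\<close> the form is a nonnegative quadratic in
  \<open>s\<close> without constant term, so its linear coefficient \<open>2 * |H y|^2\<close> must
  vanish.\<close>

lemma psd_form_zero_imp_kernel:
  fixes H :: "real^'n^'n"
  assumes sym: "transpose H = H" and psd: "\<And>x. 0 \<le> x \<bullet> (H *v x)" and "y \<bullet> (H *v y) = 0"
  shows "H *v y = 0"
proof -
  let ?w = "H *v y"
  have adj: "y \<bullet> (H *v x) = ?w \<bullet> x" for x
    using sym by (metis dot_lmul_matrix transpose_matrix_vector)
  have "0 \<le> 2 * s * (?w \<bullet> ?w) + s\<^sup>2 * (?w \<bullet> (H *v ?w))" for s :: real
  proof -
    have "0 \<le> (y + s *\<^sub>R ?w) \<bullet> (H *v (y + s *\<^sub>R ?w))" by (rule psd)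
    also have "\<dots> = y \<bullet> (H *v y) + s * (y \<bullet> (H *v ?w)) + s * (?w \<bullet> ?w) + s * s * (?w \<bullet> (H *v ?w))"
      by (simp add: matrix_vector_right_distrib matrix_vector_mult_scaleR inner_add_left inner_add_right
          inner_commute algebra_simps)
    finally show ?thesis using assms(3) by (simp add: adj power2_eq_square algebra_simps)
  qed note le = this
  have "?w \<bullet> ?w = 0"
  proof (rule ccontr)
    assume "?w \<bullet> ?w \<noteq> 0"
    then have a: "?w \<bullet> ?w > 0" by simp
    let ?a = "?w \<bullet> ?w" and ?b = "?w \<bullet> (H *v ?w)"
    have b: "?b \<ge> 0" by (rule psd)
    \<comment> \<open>At \<open>s = - r\<close> the quadratic equals
      \<open>- r^2 * (?b + 2)\<close>, which is negative; the \<open>+ 1\<close> covers the case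
      \<open>?b = 0\<close>.\<close>
    define r where "r = ?a / (?b + 1)"
    have r: "r > 0" "?a = r * (?b + 1)" using a b by (auto simp: r_def)
    have "0 \<le> 2 * (- r) * (r * (?b + 1)) + r\<^sup>2 * ?b"
      using le[of "- r"] unfolding r(2)[symmetric] by simp
    then have "r\<^sup>2 * (?b + 2) \<le> 0" by (simp add: power2_eq_square algebra_simps)
    then show False using r(1) b by (simp add: mult_le_0_iff)
  qed
  then show ?thesis by simp
qed

lemma eigenvalues_finite:
  fixes M :: "'a::field^'n^'n"
  shows "finite (eigenvalues M)"
proof -
  have "charpoly M \<noteq> 0" using degree_charpoly[of M] by auto
  then show ?thesis by (simp add: eigenvalues_eq_charpoly_roots poly_roots_finite)
qed

text \<open>A minimiser \<open>y\<close> of the form on the unit sphere, with value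
  \<open>m\<close>, is an eigenvector because \<open>G - m\<close> is positive semidefinite and its
  form vanishes at \<open>y\<close>. This identifies the least eigenvalue with the Rayleigh
  minimum.\<close>

lemma symmetric_lambda_min:
  fixes G :: "real^'n^'n"
  assumes sym: "transpose G = G"
  shows lambda_min_le_form: "lambda_min G * (x \<bullet> x) \<le> x \<bullet> (G *v x)"
    and lambda_min_eigenvector: "\<exists>y. norm y = 1 \<and> G *v y = lambda_min G *\<^sub>R y"
proof -
  have ne: "sphere (0::real^'n) 1 \<noteq> {}"
    using vector_choose_size[of 1] by (auto simp: sphere_def dist_norm)
  have "continuous_on (sphere 0 1) (\<lambda>x. x \<bullet> (G *v x))"
    by (intro continuous_intros)
  then obtain y where y: "norm y = 1" "\<And>x. norm x = 1 \<Longrightarrow> y \<bullet> (G *v y) \<le> x \<bullet> (G *v x)"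
    using continuous_attains_inf[OF compact_sphere ne] by (auto simp: sphere_def dist_norm)
  let ?m = "y \<bullet> (G *v y)"
  have ray: "?m * (x \<bullet> x) \<le> x \<bullet> (G *v x)" for x
  proof (cases "x = 0")
    case False
    then have "?m \<le> (x /\<^sub>R norm x) \<bullet> (G *v (x /\<^sub>R norm x))" by (intro y(2)) simp
    then show ?thesis using False
      by (simp add: matrix_vector_mult_scaleR field_simps power2_norm_eq_inner[symmetric] power2_eq_square)
  qed simp
  let ?H = "G - mat ?m"
  have H: "?H *v x = G *v x - ?m *\<^sub>R x" for x
    by (simp add: matrix_vector_mult_diff_rdistrib mat_mult_vector scalar_mult_eq_scaleR)
  have "transpose ?H = ?H" using sym by (simp add: transpose_def vec_eq_iff mat_def)
  then have "?H *v y = 0"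
    by (rule psd_form_zero_imp_kernel)
       (use ray y(1) in \<open>simp_all add: H inner_diff_right norm_eq_1\<close>)
  then have ey: "G *v y = ?m *\<^sub>R y" by (simp add: H)
  have "?m \<in> eigenvalues G"
    unfolding eigenvalues_def mem_Collect_eq
    by (rule exI[of _ y]) (use ey y(1) in \<open>auto simp: scalar_mult_eq_scaleR\<close>)
  moreover have "?m \<le> l" if l: "l \<in> eigenvalues G" for l
  proof -
    obtain v where v: "v \<noteq> 0" "G *v v = l *\<^sub>R v"
      using l by (auto simp: eigenvalues_def scalar_mult_eq_scaleR)
    then have "?m * (v \<bullet> v) \<le> l * (v \<bullet> v)" using ray[of v] by simp
    then show ?thesis using v(1) by simp
  qed
  ultimately have "lambda_min G = ?m"
    unfolding lambda_min_def by (intro Min_eqI eigenvalues_finite) auto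
  then show "lambda_min G * (x \<bullet> x) \<le> x \<bullet> (G *v x)" "\<exists>y. norm y = 1 \<and> G *v y = lambda_min G *\<^sub>R y"
    using ray ey y(1) by auto
qed

subsection \<open>Eigenframes of normal matrices\<close>

definition cinner :: "complex^'n \<Rightarrow> complex^'n \<Rightarrow> complex" where
  "cinner x y = (\<Sum>i\<in>UNIV. cnj (x $ i) * y $ i)"

definition cvec :: "complex^'n \<Rightarrow> complex^'n" where
  "cvec x = (\<chi> i. cnj (x $ i))"

lemma cvec_nth [simp]: "cvec x $ i = cnj (x $ i)"
  by (simp add: cvec_def)

lemma cinner_scale_left: "cinner (a *s x) y = cnj a * cinner x y"
  and cinner_scale_right: "cinner x (a *s y) = a * cinner x y"
  and cinner_diff_left: "cinner (x - x') y = cinner x y - cinner x' y"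
  and cinner_diff_right: "cinner x (y - y') = cinner x y - cinner x y'"
  by (simp_all add: cinner_def sum_distrib_left sum_subtractf algebra_simps)

lemma cinner_self: "cinner x x = of_real (\<Sum>i\<in>UNIV. (cmod (x $ i))\<^sup>2)"
  unfolding cinner_def of_real_sum complex_norm_square by (simp add: mult.commute)

lemma cinner_self_eq_0: "cinner x x = 0 \<longleftrightarrow> x = 0"
  unfolding cinner_self of_real_eq_0_iff by (subst sum_nonneg_eq_0_iff) (auto simp: vec_eq_iff)

lemma cinner_adjoint:
  fixes A :: "real^'n^'n"
  shows "cinner (map_matrix complex_of_real A *v x) y = cinner x (map_matrix complex_of_real (transpose A) *v y)"
proof -
  have "cinner (map_matrix complex_of_real A *v x) y
      = (\<Sum>i\<in>UNIV. \<Sum>j\<in>UNIV. cnj (x $ j) * of_real (A $ i $ j) * y $ i)"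
    by (simp add: cinner_def matrix_vector_mult_def map_matrix_def sum_distrib_right sum_distrib_left mult_ac)
  also have "\<dots> = (\<Sum>j\<in>UNIV. \<Sum>i\<in>UNIV. cnj (x $ j) * of_real (A $ i $ j) * y $ i)"
    by (rule sum.swap)
  also have "\<dots> = cinner x (map_matrix complex_of_real (transpose A) *v y)"
    by (simp add: cinner_def matrix_vector_mult_def map_matrix_def transpose_def sum_distrib_left mult_ac)
  finally show ?thesis .
qed

lemma map_matrix_of_real_mult:
  fixes A B :: "real^'n^'n"
  shows "map_matrix complex_of_real (A ** B) = map_matrix complex_of_real A ** map_matrix complex_of_real B"
  by (simp add: map_matrix_def matrix_matrix_mult_def vec_eq_iff)

text \<open>By normality, applying the transpose to \<open>x\<close> stays in the
  \<open>z\<close>-eigenspace of \<open>A\<close>. This evaluates all terms in the squared norm of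
  the difference of the two sides, and they cancel.\<close>

lemma normal_transpose_eigenvector:
  fixes A :: "real^'n^'n"
  assumes "normal_matrix A" and eig: "map_matrix complex_of_real A *v x = z *s x"
  shows "map_matrix complex_of_real (transpose A) *v x = cnj z *s x"
proof -
  let ?N = "map_matrix complex_of_real A" and ?H = "map_matrix complex_of_real (transpose A)"
  have adj: "cinner (?H *v u) w = cinner u (?N *v w)" for u w
    using cinner_adjoint[of "transpose A" u w] by simp
  have "?N *v (?H *v x) = ?H *v (?N *v x)"
    using assms(1) by (simp add: matrix_vector_mul_assoc map_matrix_of_real_mult[symmetric] normal_matrix_def)
  then have "?N *v (?H *v x) = z *s (?H *v x)" by (simp add: eig vector_scalar_commute)
  moreover have xH: "cinner x (?H *v x) = cnj z * cinner x x"
    by (simp add: cinner_adjoint[symmetric] eig cinner_scale_left)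
  moreover have Hx: "cinner (?H *v x) x = z * cinner x x"
    by (simp add: adj eig cinner_scale_right)
  ultimately have HH: "cinner (?H *v x) (?H *v x) = cnj z * z * cinner x x"
    by (simp add: adj cinner_scale_right)
  have "cinner (?H *v x - cnj z *s x) (?H *v x - cnj z *s x) = 0"
    unfolding cinner_diff_left cinner_diff_right cinner_scale_left cinner_scale_right HH xH Hx by simp
  then show ?thesis by (simp add: cinner_self_eq_0)
qed

lemma normal_eigenvectors_orthogonal:
  fixes A :: "real^'n^'n"
  assumes "normal_matrix A" "map_matrix complex_of_real A *v x = z *s x"
    "map_matrix complex_of_real A *v y = w *s y" "z \<noteq> w"
  shows "cinner x y = 0"
proof -
  have "w * cinner x y = cinner x (map_matrix complex_of_real A *v y)"
    by (simp add: assms cinner_scale_right)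
  also have "\<dots> = cinner (map_matrix complex_of_real (transpose A) *v x) y"
    by (simp add: cinner_adjoint)
  also have "\<dots> = z * cinner x y"
    using normal_transpose_eigenvector[OF assms(1,2)] by (simp add: cinner_scale_left)
  finally show ?thesis using assms(4) by simp
qed

lemma cvec_eigenvector:
  fixes A :: "real^'n^'n"
  assumes "map_matrix complex_of_real A *v x = z *s x"
  shows "map_matrix complex_of_real A *v cvec x = cnj z *s cvec x"
proof -
  have "map_matrix complex_of_real A *v cvec x = cvec (map_matrix complex_of_real A *v x)"
    by (simp add: vec_eq_iff matrix_vector_mult_def map_matrix_def)
  also have "\<dots> = cnj z *s cvec x" unfolding assms by (simp add: vec_eq_iff)
  finally show ?thesis .
qed

lemma unit_eigenvector_exists:
  fixes A :: "real^'n^'n"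
  assumes "z \<in> complex_spectrum A"
  shows "\<exists>x. map_matrix complex_of_real A *v x = z *s x \<and> cinner x x = 1 \<and> (Im z = 0 \<longrightarrow> cvec x = x)"
proof -
  let ?N = "map_matrix complex_of_real A"
  obtain y where y: "y \<noteq> 0" "?N *v y = z *s y"
    using assms by (auto simp: complex_spectrum_def eigenvalues_def)
  have "\<exists>x. x \<noteq> 0 \<and> ?N *v x = z *s x \<and> (Im z = 0 \<longrightarrow> cvec x = x)"
  proof (cases "Im z = 0")
    case True
    then have cy: "?N *v cvec y = z *s cvec y"
      using cvec_eigenvector[OF y(2)] by (simp add: complex_eq_iff cnj.code)
    show ?thesis
    \<comment> \<open>The sum is a real eigenvector unless it vanishes; in that case
      \<open>y\<close> is purely imaginary and its product with the imaginary unit is real.\<close>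
    proof (cases "y + cvec y = 0")
      case True
      have "cnj (y $ i) = - (y $ i)" for i
      proof -
        have "(y + cvec y) $ i = 0" unfolding True by simp
        then show ?thesis by (simp add: eq_neg_iff_add_eq_0 add.commute)
      qed
      then show ?thesis using y
        by (intro exI[of _ "\<i> *s y"]) (auto simp: vector_scalar_commute vec_eq_iff mult_ac)
    next
      case False
      then show ?thesis
        by (intro exI[of _ "y + cvec y"]) (simp add: matrix_vector_right_distrib cy y vec_eq_iff algebra_simps)
    qed
  qed (use y in auto)
  then obtain x where x: "x \<noteq> 0" "?N *v x = z *s x" "Im z = 0 \<longrightarrow> cvec x = x" by blast
  define s where "s = (\<Sum>i\<in>UNIV. (cmod (x $ i))\<^sup>2)"
  have "s \<noteq> 0"
    using x(1) cinner_self_eq_0[of x] unfolding cinner_self s_def[symmetric] by simp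
  moreover have "s \<ge> 0" unfolding s_def by (intro sum_nonneg) auto
  ultimately have s: "s > 0" by simp
  let ?a = "complex_of_real (inverse (sqrt s))"
  have "cinner (?a *s x) (?a *s x) = cnj ?a * (?a * of_real s)"
    by (simp only: cinner_scale_left cinner_scale_right) (simp only: cinner_self s_def mult.left_commute)
  also have "\<dots> = of_real (inverse (sqrt s) * (inverse (sqrt s) * s))" by simp
  also have "inverse (sqrt s) * (inverse (sqrt s) * s) = 1" using s by (simp add: field_simps)
  finally have "cinner (?a *s x) (?a *s x) = 1" by simp
  then show ?thesis using x
    by (intro exI[of _ "?a *s x"]) (auto simp: vec_eq_iff vector_scalar_commute mult_ac)
qed

lemma complex_spectrum_cnj:
  fixes A :: "real^'n^'n"
  assumes "z \<in> complex_spectrum A"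
  shows "cnj z \<in> complex_spectrum A"
proof -
  obtain y where y: "y \<noteq> 0" "map_matrix complex_of_real A *v y = z *s y"
    using assms by (auto simp: complex_spectrum_def eigenvalues_def)
  moreover have "cvec y \<noteq> 0" using y(1) by (auto simp: vec_eq_iff)
  ultimately show ?thesis
    using cvec_eigenvector[OF y(2)] by (auto simp: complex_spectrum_def eigenvalues_def)
qed

text \<open>\<open>sg\<close> is the index involution induced by conjugation of the spectrum. The
  frame is invariant under it, which turns reality of vectors and matrices into a symmetry of their
  coordinates.\<close>

locale eigenframe =
  fixes A :: "real^'n^'n" and e :: "'n \<Rightarrow> complex" and v :: "'n \<Rightarrow> complex^'n" and sg :: "'n \<Rightarrow> 'n"
  assumes inj_e: "inj e"
    and range_e: "range e = complex_spectrum A"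
    and eigenvector: "map_matrix complex_of_real A *v v k = e k *s v k"
    and transpose_eigenvector: "map_matrix complex_of_real (transpose A) *v v k = cnj (e k) *s v k"
    and orthonormal: "cinner (v k) (v l) = (if k = l then 1 else 0)"
    and e_sg: "e (sg k) = cnj (e k)"
    and v_sg: "v (sg k) = cvec (v k)"

lemma eigenframe_exists:
  fixes A :: "real^'n^'n"
  assumes "normal_matrix A" "simple_spectrum A"
  shows "\<exists>e v sg. eigenframe A e v sg"
proof -
  let ?S = "complex_spectrum A"
  obtain e where e: "bij_betw e (UNIV::'n set) ?S"
    using card_complex_spectrum[OF assms(2)] by (metis finite_same_card_bij finite)
  have eS: "e k \<in> ?S" for k using e by (auto simp: bij_betw_def)
  obtain g where g: "\<And>z. z \<in> ?S \<Longrightarrow> map_matrix complex_of_real A *v g z = z *s g z"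
      "\<And>z. z \<in> ?S \<Longrightarrow> cinner (g z) (g z) = 1" "\<And>z. z \<in> ?S \<Longrightarrow> Im z = 0 \<Longrightarrow> cvec (g z) = g z"
    using unit_eigenvector_exists[of _ A] by metis
  \<comment> \<open>Eigenvectors are chosen in the closed upper half-plane and conjugated into the
    lower one, which gives \<open>u (cnj z) = cvec (u z)\<close>; on the real axis this holds
    because \<open>g z\<close> is real.\<close>
  define u where "u z = (if Im z \<ge> 0 then g z else cvec (g (cnj z)))" for z
  have u: "map_matrix complex_of_real A *v u z = z *s u z" "cinner (u z) (u z) = 1"
    "u (cnj z) = cvec (u z)" if "z \<in> ?S" for z
  proof -
    have cz: "cnj z \<in> ?S" by (rule complex_spectrum_cnj[OF that])
    show "map_matrix complex_of_real A *v u z = z *s u z"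
      using g(1)[OF that] cvec_eigenvector[OF g(1)[OF cz]] by (simp add: u_def)
    have "cinner (cvec x) (cvec x) = cinner x x" for x :: "complex^'n"
      by (simp add: cinner_def mult.commute)
    then show "cinner (u z) (u z) = 1" using g(2) that cz by (simp add: u_def)
    have "cnj z = z" if "Im z = 0" using that by (simp add: complex_eq_iff)
    moreover have "cvec (cvec x) = x" for x :: "complex^'n" by (simp add: vec_eq_iff)
    ultimately show "u (cnj z) = cvec (u z)" using g(3)[OF that] by (auto simp: u_def)
  qed
  define sg where "sg k = inv_into UNIV e (cnj (e k))" for k
  have esg: "e (sg k) = cnj (e k)" for k
    using e complex_spectrum_cnj[OF eS[of k]] unfolding sg_def
    by (auto simp: bij_betw_def intro: f_inv_into_f)
  have "eigenframe A e (\<lambda>k. u (e k)) sg"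
  proof
    show "inj e" "range e = ?S" using e by (auto simp: bij_betw_def)
    fix k l
    show "map_matrix complex_of_real A *v u (e k) = e k *s u (e k)" using u(1) eS by blast
    then show "map_matrix complex_of_real (transpose A) *v u (e k) = cnj (e k) *s u (e k)"
      by (rule normal_transpose_eigenvector[OF assms(1)])
    show "cinner (u (e k)) (u (e l)) = (if k = l then 1 else 0)"
    proof (cases "k = l")
      case False
      then have "e k \<noteq> e l" using e by (auto simp: bij_betw_def inj_on_def)
      then show ?thesis using False normal_eigenvectors_orthogonal[OF assms(1) u(1) u(1)] eS by simp
    qed (use u(2) eS in simp)
    show "e (sg k) = cnj (e k)" by (rule esg)
    then show "u (e (sg k)) = cvec (u (e k))" using u(3)[OF eS[of k]] by simp
  qed
  then show ?thesis by blast
qed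

section \<open>Coordinates and functions of the matrix in an eigenframe\<close>

context eigenframe
begin

text \<open>Exactly the coordinate families of real vectors, by \<open>coord_sg\<close> and
  \<open>coord_surj\<close>.\<close>

definition conj_sym :: "('n \<Rightarrow> complex) \<Rightarrow> bool" where
  "conj_sym \<phi> \<longleftrightarrow> (\<forall>k. \<phi> (sg k) = cnj (\<phi> k))"

definition coord :: "real^'n \<Rightarrow> 'n \<Rightarrow> complex" where
  "coord x k = (\<Sum>i\<in>UNIV. cnj (v k $ i) * of_real (x $ i))"

text \<open>The function \<open>\<phi>\<close> of \<open>A\<close>; the sum is already real when \<open>\<phi>\<close> is conjugation symmetric.\<close>

definition fun_mat :: "('n \<Rightarrow> complex) \<Rightarrow> real^'n^'n" where
  "fun_mat \<phi> = (\<chi> i j. Re (\<Sum>k\<in>UNIV. v k $ i * \<phi> k * cnj (v k $ j)))"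

definition matrix_coord :: "real^'n^'n \<Rightarrow> 'n \<Rightarrow> 'n \<Rightarrow> complex" where
  "matrix_coord M k l = cinner (v k) (map_matrix complex_of_real M *v v l)"

lemma sg_sg [simp]: "sg (sg k) = k"
  using inj_e by (auto simp: e_sg inj_on_def)

lemma bij_sg: "bij sg"
  by (metis bij_betw_byWitness subset_UNIV sg_sg)

lemma sum_sg: "(\<Sum>k\<in>UNIV. f (sg k)) = (\<Sum>k\<in>UNIV. f k)"
  by (rule sum.reindex_bij_betw[OF bij_sg])

lemma conj_symD: "conj_sym \<phi> \<Longrightarrow> \<phi> (sg k) = cnj (\<phi> k)"
  by (simp add: conj_sym_def)

text \<open>Orthonormality says that the conjugate transpose of the frame matrix is a left inverse;
  for a square matrix it is then also a right inverse.\<close>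

lemma complete: "(\<Sum>k\<in>UNIV. v k $ i * cnj (v k $ j)) = (if i = j then 1 else 0)"
proof -
  define V :: "complex^'n^'n" where "V = (\<chi> i k. v k $ i)"
  define W :: "complex^'n^'n" where "W = (\<chi> k i. cnj (v k $ i))"
  have "W ** V = mat 1"
    using orthonormal
    by (simp add: W_def V_def matrix_matrix_mult_def mat_def vec_eq_iff cinner_def)
  then have "V ** W = mat 1" by (simp add: matrix_left_right_inverse)
  then have "(V ** W) $ i $ j = mat 1 $ i $ j" by simp
  then show ?thesis by (simp add: V_def W_def matrix_matrix_mult_def mat_def)
qed

lemma coord_sg: "coord x (sg k) = cnj (coord x k)"
  by (simp add: coord_def v_sg)

lemma synthesis: "of_real (x $ i) = (\<Sum>k\<in>UNIV. v k $ i * coord x k)"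
proof -
  have "(\<Sum>k\<in>UNIV. v k $ i * coord x k) = (\<Sum>j\<in>UNIV. (\<Sum>k\<in>UNIV. v k $ i * cnj (v k $ j)) * of_real (x $ j))"
    unfolding coord_def sum_distrib_left sum_distrib_right
    by (subst sum.swap) (simp add: mult_ac)
  then show ?thesis by (simp add: complete if_distrib[of "\<lambda>a. a * _"] cong: if_cong)
qed

lemma coord_inject: "coord x = coord y \<Longrightarrow> x = y"
  using synthesis[of x] synthesis[of y] by (simp add: vec_eq_iff of_real_eq_iff[symmetric, where 'a = complex])

lemma sum_conj_sym_real:
  assumes "conj_sym \<phi>"
  shows "of_real (Re (\<Sum>k\<in>UNIV. \<phi> k)) = (\<Sum>k\<in>UNIV. \<phi> k)"
proof -
  have "cnj (\<Sum>k\<in>UNIV. \<phi> k) = (\<Sum>k\<in>UNIV. \<phi> (sg k))"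
    using assms by (simp add: conj_sym_def)
  also have "\<dots> = (\<Sum>k\<in>UNIV. \<phi> k)" by (rule sum_sg)
  finally show ?thesis by (metis Reals_cnj_iff of_real_Re)
qed

lemma coord_surj:
  assumes "conj_sym \<phi>"
  shows "\<exists>x. coord x = \<phi>"
proof -
  define x :: "real^'n" where "x = (\<chi> i. Re (\<Sum>l\<in>UNIV. v l $ i * \<phi> l))"
  have x: "of_real (x $ i) = (\<Sum>l\<in>UNIV. v l $ i * \<phi> l)" for i
    unfolding x_def vec_lambda_beta
    by (rule sum_conj_sym_real) (use assms in \<open>simp add: conj_sym_def v_sg\<close>)
  have "coord x k = \<phi> k" for k
  proof -
    have "coord x k = (\<Sum>l\<in>UNIV. cinner (v k) (v l) * \<phi> l)"
      unfolding coord_def cinner_def x sum_distrib_left sum_distrib_right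
      by (subst sum.swap) (simp add: mult_ac)
    then show ?thesis by (simp add: orthonormal if_distrib[of "\<lambda>a. a * _"] cong: if_cong)
  qed
  then show ?thesis by blast
qed

lemma parseval: "of_real (x \<bullet> y) = (\<Sum>k\<in>UNIV. cnj (coord x k) * coord y k)"
proof -
  have "of_real (x \<bullet> y) = (\<Sum>i\<in>UNIV. of_real (x $ i) * (\<Sum>k\<in>UNIV. v k $ i * coord y k))"
    by (simp add: inner_vec_def synthesis[symmetric])
  also have "\<dots> = (\<Sum>k\<in>UNIV. \<Sum>i\<in>UNIV. of_real (x $ i) * (v k $ i * coord y k))"
    unfolding sum_distrib_left by (rule sum.swap)
  also have "\<dots> = (\<Sum>k\<in>UNIV. cnj (coord x k) * coord y k)"
    by (simp add: coord_def sum_distrib_right mult_ac)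
  finally show ?thesis .
qed

lemma parseval_norm: "x \<bullet> x = (\<Sum>k\<in>UNIV. (cmod (coord x k))\<^sup>2)"
proof -
  have "complex_of_real (x \<bullet> x) = of_real (\<Sum>k\<in>UNIV. (cmod (coord x k))\<^sup>2)"
    unfolding parseval of_real_sum complex_norm_square by (simp add: mult.commute)
  then show ?thesis by (simp only: of_real_eq_iff)
qed

lemma coord_matrix: "coord (M *v x) k = (\<Sum>l\<in>UNIV. matrix_coord M k l * coord x l)"
proof -
  have "coord (M *v x) k = (\<Sum>i\<in>UNIV. \<Sum>j\<in>UNIV. cnj (v k $ i) * of_real (M $ i $ j) * (\<Sum>l\<in>UNIV. v l $ j * coord x l))"
    unfolding coord_def[of "M *v x"]
    by (simp add: matrix_vector_mult_def synthesis[symmetric] sum_distrib_left mult_ac)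
  also have "\<dots> = (\<Sum>i\<in>UNIV. \<Sum>l\<in>UNIV. \<Sum>j\<in>UNIV. cnj (v k $ i) * of_real (M $ i $ j) * (v l $ j * coord x l))"
    unfolding sum_distrib_left by (rule sum.cong[OF refl], rule sum.swap)
  also have "\<dots> = (\<Sum>l\<in>UNIV. \<Sum>i\<in>UNIV. \<Sum>j\<in>UNIV. cnj (v k $ i) * of_real (M $ i $ j) * (v l $ j * coord x l))"
    by (rule sum.swap)
  also have "\<dots> = (\<Sum>l\<in>UNIV. matrix_coord M k l * coord x l)"
    by (simp add: matrix_coord_def cinner_def matrix_vector_mult_def map_matrix_def sum_distrib_left sum_distrib_right mult_ac)
  finally show ?thesis .
qed

lemma coord_A: "coord (A *v x) k = e k * coord x k"
  unfolding coord_matrix matrix_coord_def eigenvector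
  by (simp add: cinner_scale_right orthonormal if_distrib[of "\<lambda>a. _ * a * _"] if_distrib[of "\<lambda>a. _ * a"]
      if_distrib[of "\<lambda>a. a * _"] cong: if_cong)

lemma matrix_coord_conj: "matrix_coord M (sg k) (sg l) = cnj (matrix_coord M k l)"
  by (simp add: matrix_coord_def cinner_def matrix_vector_mult_def map_matrix_def v_sg)

lemma coord_fun_mat:
  assumes "conj_sym \<phi>"
  shows "coord (fun_mat \<phi> *v x) k = \<phi> k * coord x k"
proof -
  have "complex_of_real (fun_mat \<phi> $ i $ j) = (\<Sum>k\<in>UNIV. v k $ i * \<phi> k * cnj (v k $ j))" for i j
    unfolding fun_mat_def vec_lambda_beta
    by (rule sum_conj_sym_real) (use assms in \<open>simp add: conj_sym_def v_sg\<close>)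
  then have "matrix_coord (fun_mat \<phi>) k l = (\<Sum>i\<in>UNIV. \<Sum>j\<in>UNIV. \<Sum>m\<in>UNIV. cnj (v k $ i) * (v m $ i * \<phi> m * cnj (v m $ j)) * v l $ j)" for l
    by (simp add: matrix_coord_def cinner_def matrix_vector_mult_def map_matrix_def sum_distrib_left sum_distrib_right mult_ac)
  also have "\<dots> l = (\<Sum>m\<in>UNIV. cinner (v k) (v m) * \<phi> m * cinner (v m) (v l))" for l
  proof -
    have "(\<Sum>i\<in>UNIV. \<Sum>j\<in>UNIV. \<Sum>m\<in>UNIV. cnj (v k $ i) * (v m $ i * \<phi> m * cnj (v m $ j)) * v l $ j)
      = (\<Sum>i\<in>UNIV. \<Sum>m\<in>UNIV. \<Sum>j\<in>UNIV. cnj (v k $ i) * (v m $ i * \<phi> m * cnj (v m $ j)) * v l $ j)"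
      by (rule sum.cong[OF refl], rule sum.swap)
    also have "\<dots> = (\<Sum>m\<in>UNIV. \<Sum>i\<in>UNIV. \<Sum>j\<in>UNIV. cnj (v k $ i) * (v m $ i * \<phi> m * cnj (v m $ j)) * v l $ j)"
      by (rule sum.swap)
    also have "\<dots> = (\<Sum>m\<in>UNIV. cinner (v k) (v m) * \<phi> m * cinner (v m) (v l))"
      by (simp add: cinner_def sum_distrib_left sum_distrib_right mult_ac)
    finally show ?thesis .
  qed
  finally have "matrix_coord (fun_mat \<phi>) k l = (if k = l then \<phi> k else 0)" for l
    by (simp add: orthonormal if_distrib[of "\<lambda>a. _ * a"] if_distrib[of "\<lambda>a. a * _"] cong: if_cong)
  then show ?thesis
    by (simp add: coord_matrix if_distrib[of "\<lambda>a. a * _"] cong: if_cong)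
qed

lemma matrix_eqI_coord:
  assumes "\<And>x k. coord (M *v x) k = coord (N *v x) k"
  shows "M = N"
proof -
  have "M *v x = N *v x" for x using assms by (intro coord_inject) auto
  then show ?thesis by (simp add: matrix_eq)
qed

lemma fun_mat_mult: "conj_sym \<phi> \<Longrightarrow> conj_sym \<psi> \<Longrightarrow> fun_mat \<phi> ** fun_mat \<psi> = fun_mat (\<lambda>k. \<phi> k * \<psi> k)"
proof (rule matrix_eqI_coord)
  fix x k
  assume "conj_sym \<phi>" "conj_sym \<psi>"
  moreover then have "conj_sym (\<lambda>k. \<phi> k * \<psi> k)" by (simp add: conj_sym_def)
  ultimately show "coord (fun_mat \<phi> ** fun_mat \<psi> *v x) k = coord (fun_mat (\<lambda>k. \<phi> k * \<psi> k) *v x) k"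
    by (simp add: matrix_vector_mul_assoc[symmetric] coord_fun_mat)
qed

lemma fun_mat_one: "fun_mat (\<lambda>k. 1) = mat 1"
  by (rule matrix_eqI_coord) (simp add: coord_fun_mat conj_sym_def)

lemma fun_mat_e: "fun_mat e = A"
  by (rule matrix_eqI_coord) (simp add: coord_fun_mat conj_sym_def coord_A e_sg)

lemma transpose_fun_mat: "transpose (fun_mat \<phi>) = fun_mat (\<lambda>k. cnj (\<phi> k))"
proof -
  have "(\<Sum>k\<in>UNIV. v k $ j * \<phi> k * cnj (v k $ i)) = cnj (\<Sum>k\<in>UNIV. v k $ i * cnj (\<phi> k) * cnj (v k $ j))" for i j
    by (simp add: mult_ac)
  then show ?thesis by (simp add: transpose_def fun_mat_def vec_eq_iff del: Re_sum cnj_sum)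
qed

lemma fun_mat_inject:
  assumes "conj_sym \<phi>" "conj_sym \<psi>" "fun_mat \<phi> = fun_mat \<psi>"
  shows "\<phi> = \<psi>"
proof
  fix k
  obtain x where "coord x = (\<lambda>k. 1)" using coord_surj[of "\<lambda>k. 1"] by (auto simp: conj_sym_def)
  then show "\<phi> k = \<psi> k" using coord_fun_mat[OF assms(1), of x k] coord_fun_mat[OF assms(2), of x k] assms(3) by simp
qed

lemma fun_mat_power: "conj_sym \<phi> \<Longrightarrow> (((**) (fun_mat \<phi>)) ^^ m) (mat 1) = fun_mat (\<lambda>k. \<phi> k ^ m)"
proof (induction m)
  case 0
  then show ?case by (simp add: fun_mat_one)
next
  case (Suc m)
  moreover have "conj_sym (\<lambda>k. \<phi> k ^ m)" using Suc.prems by (simp add: conj_sym_def)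
  ultimately show ?case by (simp add: fun_mat_mult)
qed

lemma scaleR_fun_mat: "s *\<^sub>R fun_mat \<phi> = fun_mat (\<lambda>k. of_real s * \<phi> k)"
proof -
  have "s * Re (\<Sum>k\<in>UNIV. v k $ i * \<phi> k * cnj (v k $ j)) = Re (of_real s * (\<Sum>k\<in>UNIV. v k $ i * \<phi> k * cnj (v k $ j)))" for i j
    by simp
  then show ?thesis
    by (simp add: fun_mat_def vec_eq_iff sum_distrib_left mult_ac del: Re_sum)
qed

text \<open>Powers act on the symbol, so every entry of a partial sum is a fixed finite combination
  of partial sums of scalar exponential series. Convergence is therefore checked entrywise.\<close>

lemma matrix_exp_fun_mat:
  assumes "conj_sym \<phi>"
  shows "matrix_exp (fun_mat \<phi>) = fun_mat (\<lambda>k. exp (\<phi> k))"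
proof -
  let ?f = "\<lambda>m. (1 / fact m) *\<^sub>R (((**) (fun_mat \<phi>)) ^^ m) (mat 1)"
  have f: "?f m = fun_mat (\<lambda>k. \<phi> k ^ m /\<^sub>R fact m)" for m
    unfolding fun_mat_power[OF assms] scaleR_fun_mat
    by (simp add: scaleR_conv_of_real divide_simps)
  have "(\<lambda>m. Re (\<Sum>k\<in>UNIV. v k $ i * (\<phi> k ^ m /\<^sub>R fact m) * cnj (v k $ j)))
      sums Re (\<Sum>k\<in>UNIV. v k $ i * exp (\<phi> k) * cnj (v k $ j))" for i j
    by (intro sums_Re sums_sum sums_mult sums_mult2 exp_converges)
  then have "(\<lambda>m. ?f m $ i $ j) sums fun_mat (\<lambda>k. exp (\<phi> k)) $ i $ j" for i j
    unfolding f by (simp add: fun_mat_def del: Re_sum)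
  then have "?f sums fun_mat (\<lambda>k. exp (\<phi> k))"
    unfolding sums_def by (auto intro!: vec_tendstoI)
  then show ?thesis unfolding matrix_exp_def by (simp add: sums_iff)
qed

lemma matrix_exp_A:
  "matrix_exp (t *\<^sub>R A) = fun_mat (\<lambda>k. exp (of_real t * e k))"
  "matrix_exp (t *\<^sub>R transpose A) = transpose (fun_mat (\<lambda>k. exp (of_real t * e k)))"
proof -
  have "conj_sym (\<lambda>k. of_real t * e k)" "conj_sym (\<lambda>k. of_real t * cnj (e k))"
    by (simp_all add: conj_sym_def e_sg)
  then show "matrix_exp (t *\<^sub>R A) = fun_mat (\<lambda>k. exp (of_real t * e k))"
    "matrix_exp (t *\<^sub>R transpose A) = transpose (fun_mat (\<lambda>k. exp (of_real t * e k)))"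
    unfolding fun_mat_e[symmetric] transpose_fun_mat scaleR_fun_mat
    by (simp_all add: matrix_exp_fun_mat exp_cnj)
qed

text \<open>Evaluating \<open>R ** A = A ** R\<close> between \<open>v k\<close> and
  \<open>v l\<close> gives \<open>(e l - e k) * matrix_coord R k l = 0\<close>, so distinct
  eigenvalues make \<open>R\<close> diagonal in the frame.\<close>

lemma commuting_imp_fun_mat:
  assumes "R ** A = A ** R"
  shows "R = fun_mat (\<lambda>k. matrix_coord R k k)" "conj_sym (\<lambda>k. matrix_coord R k k)"
proof -
  show cs: "conj_sym (\<lambda>k. matrix_coord R k k)" by (simp add: conj_sym_def matrix_coord_conj)
  have off: "matrix_coord R k l = 0" if "k \<noteq> l" for k l
  proof -
    let ?R = "map_matrix complex_of_real R" and ?A = "map_matrix complex_of_real A"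
    have "e l * matrix_coord R k l = cinner (v k) (?R *v (?A *v v l))"
      by (simp add: matrix_coord_def eigenvector vector_scalar_commute cinner_scale_right)
    also have "\<dots> = cinner (v k) (?A *v (?R *v v l))"
      using assms by (simp add: matrix_vector_mul_assoc map_matrix_of_real_mult[symmetric])
    also have "\<dots> = cinner (map_matrix complex_of_real (transpose A) *v v k) (?R *v v l)"
      by (simp add: cinner_adjoint)
    also have "\<dots> = e k * matrix_coord R k l"
      by (simp add: transpose_eigenvector cinner_scale_left matrix_coord_def)
    finally show ?thesis using that inj_e by (auto simp: inj_on_def)
  qed
  have "coord (R *v x) k = matrix_coord R k k * coord x k" for x k
    unfolding coord_matrix by (subst sum.remove[of _ k]) (auto simp: off intro!: sum.neutral)
  then show "R = fun_mat (\<lambda>k. matrix_coord R k k)"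
    by (intro matrix_eqI_coord) (simp add: coord_fun_mat[OF cs])
qed

text \<open>The matrix commutes with \<open>A\<close>, hence is the \<open>fun_mat\<close> of its
  own diagonal, and symbols are unique.\<close>

lemma matrix_coord_fun_mat:
  assumes "conj_sym \<phi>"
  shows "matrix_coord (fun_mat \<phi>) k k = \<phi> k"
proof -
  have "fun_mat \<phi> ** A = A ** fun_mat \<phi>"
    using fun_mat_mult[OF assms, of e] fun_mat_mult[OF _ assms, of e]
    by (simp add: conj_sym_def e_sg fun_mat_e mult.commute)
  from commuting_imp_fun_mat[OF this] show ?thesis
    using fun_mat_inject[OF assms] by metis
qed

lemma orthogonal_fun_mat_iff:
  assumes "conj_sym \<phi>"
  shows "orthogonal_matrix (fun_mat \<phi>) \<longleftrightarrow> (\<forall>k. cmod (\<phi> k) = 1)"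
proof -
  have cs: "conj_sym (\<lambda>k. cnj (\<phi> k))" "conj_sym (\<lambda>k. cnj (\<phi> k) * \<phi> k)" "conj_sym (\<lambda>k. 1)"
    using assms by (simp_all add: conj_sym_def)
  have "orthogonal_matrix (fun_mat \<phi>) \<longleftrightarrow> fun_mat (\<lambda>k. cnj (\<phi> k) * \<phi> k) = fun_mat (\<lambda>k. 1)"
    by (simp add: orthogonal_matrix transpose_fun_mat fun_mat_mult cs assms fun_mat_one)
  also have "\<dots> \<longleftrightarrow> (\<forall>k. cnj (\<phi> k) * \<phi> k = 1)"
    using fun_mat_inject[OF cs(2,3)] by (auto simp: fun_eq_iff)
  also have "\<dots> \<longleftrightarrow> (\<forall>k. cmod (\<phi> k) = 1)"
  proof -
    have "cnj z * z = of_real ((cmod z)\<^sup>2)" for z by (simp only: complex_norm_square mult.commute)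
    then show ?thesis by (simp add: power2_eq_1_iff of_real_power[symmetric] del: of_real_power)
      (metis norm_ge_zero not_one_le_zero neg_0_le_iff_le)
  qed
  finally show ?thesis .
qed

lemma orthogonal_centralizer_eq:
  "carrier (orthogonal_centralizer A) = {fun_mat \<phi> | \<phi>. conj_sym \<phi> \<and> (\<forall>k. cmod (\<phi> k) = 1)}"
proof (rule Set.set_eqI, rule iffI)
  fix R
  assume "R \<in> carrier (orthogonal_centralizer A)"
  then have R: "orthogonal_matrix R" "R ** A = A ** R" by (auto simp: orthogonal_centralizer_def)
  note c = commuting_imp_fun_mat[OF R(2)]
  from R(1) c(1) have "\<forall>k. cmod (matrix_coord R k k) = 1" using orthogonal_fun_mat_iff[OF c(2)] by simp
  then show "R \<in> {fun_mat \<phi> | \<phi>. conj_sym \<phi> \<and> (\<forall>k. cmod (\<phi> k) = 1)}" using c by blast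
next
  fix R
  assume "R \<in> {fun_mat \<phi> | \<phi>. conj_sym \<phi> \<and> (\<forall>k. cmod (\<phi> k) = 1)}"
  then obtain \<phi> where \<phi>: "R = fun_mat \<phi>" "conj_sym \<phi>" "\<forall>k. cmod (\<phi> k) = 1" by blast
  have "fun_mat \<phi> ** A = A ** fun_mat \<phi>"
    using fun_mat_mult[OF \<phi>(2), of e] fun_mat_mult[OF _ \<phi>(2), of e]
    by (simp add: conj_sym_def e_sg fun_mat_e mult.commute)
  then show "R \<in> carrier (orthogonal_centralizer A)"
    using \<phi> orthogonal_fun_mat_iff[OF \<phi>(2)] by (simp add: orthogonal_centralizer_def)
qed

end

subsection \<open>The Gramian in an eigenframe\<close>

lemma continuous_on_exp_energy:
  assumes "\<And>k. k \<in> I \<Longrightarrow> continuous_on X (\<lambda>x. c x k)"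
  shows "continuous_on X (\<lambda>x. exp_energy I e T (c x))"
proof -
  have "continuous_on X (\<lambda>x. integral (cbox 0 T) (\<lambda>t. (cmod (exp_sum I e (c x) t))\<^sup>2))"
  proof (rule integral_continuous_on_param)
    show "continuous_on (X \<times> cbox 0 T) (\<lambda>(x, t). (cmod (exp_sum I e (c x) t))\<^sup>2)"
      unfolding exp_sum_def case_prod_unfold
      by (intro continuous_intros continuous_on_compose2[OF assms]) auto
  qed
  then show ?thesis by (simp add: exp_energy_def)
qed

lemma rank_one_sandwich:
  fixes E :: "real^'n^'n"
  shows "E ** (columnvector b ** (rowvector b :: real^'n^1)) ** transpose E
       = (\<chi> i j. (E *v b) $ i * (E *v b) $ j)"
proof -
  have cr: "(columnvector b ** (rowvector b :: real^'n^1)) $ i $ j = b $ i * b $ j" for i j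
    by (simp add: columnvector_def rowvector_def matrix_matrix_mult_def)
  have right: "(\<chi> i j. y $ i * b $ j) ** transpose E = (\<chi> i j. y $ i * (E *v b) $ j)" for y :: "real^'n"
    by (simp add: vec_eq_iff matrix_matrix_mult_def transpose_def matrix_vector_mult_def sum_distrib_left mult_ac)
  have "E ** (columnvector b ** (rowvector b :: real^'n^1)) = (\<chi> i j. (E *v b) $ i * b $ j)"
    by (simp add: vec_eq_iff matrix_matrix_mult_def[of E] cr matrix_vector_mult_def sum_distrib_left mult_ac)
  then show ?thesis by (simp only: right)
qed

lemma rank_one_form: "x \<bullet> ((\<chi> i j. y $ i * y $ j) *v x) = (x \<bullet> y)\<^sup>2" for x y :: "real^'n"
  by (simp add: inner_vec_def matrix_vector_mult_def power2_eq_square sum_product sum_distrib_left mult_ac)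

context eigenframe
begin

text \<open>The coefficients whose exponential sum at time \<open>t\<close> is the inner product of
  \<open>x\<close> with \<open>exp (t A) b\<close>; the Gramian form depends on \<open>b\<close> and
  \<open>x\<close> only through them.\<close>

definition response :: "real^'n \<Rightarrow> real^'n \<Rightarrow> 'n \<Rightarrow> complex" where
  "response b x k = cnj (coord x k) * coord b k"

lemma gramian_integrand:
  "matrix_exp (t *\<^sub>R A) ** (columnvector b ** (rowvector b :: real^'n^1)) ** matrix_exp (t *\<^sub>R transpose A)
   = (\<chi> i j. (fun_mat (\<lambda>k. exp (of_real t * e k)) *v b) $ i * (fun_mat (\<lambda>k. exp (of_real t * e k)) *v b) $ j)"
  unfolding matrix_exp_A by (rule rank_one_sandwich)

lemma gramian_integrand_integrable:
  "(\<lambda>t. matrix_exp (t *\<^sub>R A) ** (columnvector b ** (rowvector b :: real^'n^1)) ** matrix_exp (t *\<^sub>R transpose A))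
     integrable_on {0..T}"
  unfolding gramian_integrand
  by (intro integrable_continuous_real continuous_on_vec_lambda)
     (auto simp: matrix_vector_mult_def fun_mat_def simp del: Re_sum intro!: continuous_intros)

lemma gramian_form:
  "x \<bullet> (gramian T A b *v x) = exp_energy UNIV e T (response b x)"
proof -
  let ?M = "\<lambda>t. matrix_exp (t *\<^sub>R A) ** (columnvector b ** (rowvector b :: real^'n^1)) ** matrix_exp (t *\<^sub>R transpose A)"
  have bl: "bounded_linear (\<lambda>M. x \<bullet> (M *v x))"
    unfolding linear_conv_bounded_linear[symmetric]
    by (rule linearI) (simp_all add: matrix_vector_mult_add_rdistrib inner_add_right scaleR_matrix_vector_assoc[symmetric])
  have form: "x \<bullet> (?M t *v x) = (cmod (exp_sum UNIV e (response b x) t))\<^sup>2" for t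
  proof -
    have "conj_sym (\<lambda>k. exp (of_real t * e k))" by (simp add: conj_sym_def e_sg exp_cnj)
    then have "of_real (x \<bullet> (fun_mat (\<lambda>k. exp (of_real t * e k)) *v b)) = exp_sum UNIV e (response b x) t"
      by (simp add: parseval coord_fun_mat exp_sum_def response_def mult_ac)
    from this[symmetric] show ?thesis unfolding gramian_integrand rank_one_form by simp
  qed
  have "x \<bullet> (gramian T A b *v x) = integral {0..T} ((\<lambda>M. x \<bullet> (M *v x)) \<circ> ?M)"
    unfolding gramian_def by (rule integral_linear[OF gramian_integrand_integrable bl, symmetric])
  then show ?thesis by (simp add: o_def form exp_energy_def)
qed

lemma gramian_symmetric: "transpose (gramian T A b) = gramian T A b"
proof -
  let ?M = "\<lambda>t. matrix_exp (t *\<^sub>R A) ** (columnvector b ** (rowvector b :: real^'n^1)) ** matrix_exp (t *\<^sub>R transpose A)"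
  have bl: "bounded_linear (transpose :: real^'n^'n \<Rightarrow> _)"
    unfolding linear_conv_bounded_linear[symmetric]
    by (rule linearI) (simp_all add: transpose_def vec_eq_iff)
  have "transpose (gramian T A b) = integral {0..T} (transpose \<circ> ?M)"
    unfolding gramian_def by (rule integral_linear[OF gramian_integrand_integrable bl, symmetric])
  also have "transpose \<circ> ?M = ?M"
    unfolding gramian_integrand by (rule ext) (simp add: transpose_def vec_eq_iff mult.commute)
  finally show ?thesis by (simp add: gramian_def)
qed

lemma lambda_min_le_energy:
  "lambda_min (gramian T A b) * (x \<bullet> x) \<le> exp_energy UNIV e T (response b x)"
  using lambda_min_le_form[OF gramian_symmetric] unfolding gramian_form .

lemma lambda_min_attained:
  "\<exists>y. norm y = 1 \<and> exp_energy UNIV e T (response b y) = lambda_min (gramian T A b)"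
proof -
  obtain y where y: "norm y = 1" "gramian T A b *v y = lambda_min (gramian T A b) *\<^sub>R y"
    using lambda_min_eigenvector[OF gramian_symmetric] by blast
  then have "y \<bullet> (gramian T A b *v y) = lambda_min (gramian T A b)"
    by (simp add: norm_eq_1)
  then show ?thesis using y(1) unfolding gramian_form by blast
qed

section \<open>The maximum over unit vectors and the weights of its maximisers\<close>

lemma continuous_on_coord: "continuous_on X (\<lambda>x. coord x k)"
  unfolding coord_def by (intro continuous_intros)

lemma continuous_on_response_energy: "continuous_on X (\<lambda>b. exp_energy UNIV e T (response b x))"
  by (rule continuous_on_exp_energy) (auto simp: response_def intro!: continuous_intros continuous_on_coord)

text \<open>A fixed unit test vector bounds the eigenvalue by an energy that is continuous in
  \<open>b\<close> on the compact sphere. This makes the supremum in \<open>gamma1\<close> a genuine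
  upper bound.\<close>

lemma lambda_min_bdd_above: "bdd_above ((\<lambda>b. lambda_min (gramian T A b)) ` {b. norm b = 1})"
proof -
  obtain x :: "real^'n" where x: "norm x = 1" using vector_choose_size[of 1] by auto
  have "compact ((\<lambda>b. exp_energy UNIV e T (response b x)) ` sphere 0 1)"
    by (intro compact_continuous_image continuous_on_response_energy compact_sphere)
  then have "bdd_above ((\<lambda>b. exp_energy UNIV e T (response b x)) ` sphere 0 1)"
    by (intro bounded_imp_bdd_above compact_imp_bounded)
  then obtain M where M: "\<And>b. norm b = 1 \<Longrightarrow> exp_energy UNIV e T (response b x) \<le> M"
    unfolding bdd_above_def by (metis imageI dist_0_norm mem_sphere)
  have "lambda_min (gramian T A b) \<le> M" if "norm b = 1" for b
    using lambda_min_le_energy[of T b x] M[OF that] x by (simp add: norm_eq_1)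
  then show ?thesis by (auto simp: bdd_above_def)
qed

lemma lambda_min_le_gamma1: "norm b = 1 \<Longrightarrow> lambda_min (gramian T A b) \<le> gamma1 A T"
  unfolding gamma1_def by (rule cSUP_upper[OF _ lambda_min_bdd_above]) simp

text \<open>As an infimum of functions continuous in \<open>b\<close>, the smallest eigenvalue is upper semicontinuous.\<close>

lemma gamma1_attained: "\<exists>b. norm b = 1 \<and> lambda_min (gramian T A b) = gamma1 A T"
proof -
  obtain x0 :: "real^'n" where x0: "norm x0 = 1" using vector_choose_size[of 1] by auto
  have "\<exists>b. norm b = 1 \<and> gamma1 A T - inverse (real (Suc n)) < lambda_min (gramian T A b)" for n
  proof -
    have ne: "{b :: real^'n. norm b = 1} \<noteq> {}" using x0 by blast
    have "gamma1 A T - inverse (real (Suc n)) < gamma1 A T" by simp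
    then show ?thesis
      unfolding gamma1_def[of A T] less_cSUP_iff[OF ne lambda_min_bdd_above] by blast
  qed
  then obtain B where B: "\<And>n. norm (B n) = 1"
      "\<And>n. gamma1 A T - inverse (real (Suc n)) < lambda_min (gramian T A (B n))"
    by metis
  have "\<forall>n. B n \<in> sphere 0 1" using B(1) by simp
  then obtain b r where b: "b \<in> sphere 0 1" and r: "strict_mono r" "(B \<circ> r) \<longlonglongrightarrow> b"
    using compact_sphere[of 0 1] unfolding compact_def by metis
  have "gamma1 A T \<le> exp_energy UNIV e T (response b x)" if x: "norm x = 1" for x
  proof (rule tendsto_le)
    show "(\<lambda>n. exp_energy UNIV e T (response ((B \<circ> r) n) x)) \<longlonglongrightarrow> exp_energy UNIV e T (response b x)"
      using continuous_on_tendsto_compose[OF continuous_on_response_energy[of UNIV] r(2)] by simp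
    show "(\<lambda>n. gamma1 A T - inverse (real (Suc (r n)))) \<longlonglongrightarrow> gamma1 A T"
      using tendsto_diff[OF tendsto_const LIMSEQ_subseq_LIMSEQ[OF LIMSEQ_inverse_real_of_nat r(1)]]
      by (simp add: o_def)
    show "\<forall>\<^sub>F n in sequentially. gamma1 A T - inverse (real (Suc (r n))) \<le> exp_energy UNIV e T (response ((B \<circ> r) n) x)"
    proof (rule always_eventually, rule allI)
      fix n
      show "gamma1 A T - inverse (real (Suc (r n))) \<le> exp_energy UNIV e T (response ((B \<circ> r) n) x)"
        using B(2)[of "r n"] lambda_min_le_energy[of T "B (r n)" x] x by (simp add: norm_eq_1)
    qed
  qed simp
  moreover obtain y where "norm y = 1" "exp_energy UNIV e T (response b y) = lambda_min (gramian T A b)"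
    using lambda_min_attained by blast
  ultimately have "gamma1 A T \<le> lambda_min (gramian T A b)" by metis
  then show ?thesis using lambda_min_le_gamma1[of b T] b by (intro exI[of _ b]) simp
qed

text \<open>The Rayleigh bound after the substitution \<open>c = response b x\<close>. Nonzero
  coordinates of \<open>b\<close> make it invertible, and symmetry of \<open>c\<close> makes the
  resulting \<open>x\<close> real.\<close>

lemma lambda_min_le_weighted:
  assumes "conj_sym c" and nz: "\<And>k. coord b k \<noteq> 0"
  shows "lambda_min (gramian T A b) * (\<Sum>k\<in>UNIV. (cmod (c k))\<^sup>2 / (cmod (coord b k))\<^sup>2) \<le> exp_energy UNIV e T c"
proof -
  have "conj_sym (\<lambda>k. cnj (c k / coord b k))"
    using assms(1) by (simp add: conj_sym_def coord_sg)
  then obtain x where x: "coord x = (\<lambda>k. cnj (c k / coord b k))" using coord_surj by blast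
  have "response b x = c" using nz by (simp add: response_def x fun_eq_iff)
  moreover have "x \<bullet> x = (\<Sum>k\<in>UNIV. (cmod (c k))\<^sup>2 / (cmod (coord b k))\<^sup>2)"
    by (simp add: parseval_norm x norm_divide power_divide)
  ultimately show ?thesis using lambda_min_le_energy[of T b x] by simp
qed

lemma conj_sym_response: "conj_sym (response b x)"
  by (simp add: conj_sym_def response_def coord_sg)

text \<open>Conjugation permutes the nodes, hence the factors of the products. This admits the
  Lagrange weights as a test family in \<open>lambda_min_le_weighted\<close>.\<close>

lemma conj_sym_lagrange_weight: "conj_sym (lagrange_weight UNIV e)"
  unfolding conj_sym_def
proof
  fix k
  have "bij_betw sg (UNIV - {k}) (UNIV - {sg k})"
    by (rule bij_betw_byWitness[of _ sg]) (auto dest: arg_cong[of _ _ sg])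
  then have "(\<Prod>j\<in>UNIV - {k}. inverse (e (sg k) - e (sg j))) = lagrange_weight UNIV e (sg k)"
    unfolding lagrange_weight_def by (rule prod.reindex_bij_betw)
  then show "lagrange_weight UNIV e (sg k) = cnj (lagrange_weight UNIV e k)"
    by (simp add: lagrange_weight_def e_sg)
qed

lemma energy_positive:
  "\<forall>\<^sub>F T in at_right 0. \<forall>c. (\<exists>k. c k \<noteq> 0) \<longrightarrow> 0 < exp_energy UNIV e T c"
proof -
  have "\<forall>\<^sub>F T in at_right 0. \<forall>c. c k \<noteq> 0 \<longrightarrow> 0 < exp_energy UNIV e T c" for k
  proof -
    define N where "N = 2 * card (UNIV - {k}) + 1"
    have "\<exists>K>0. \<forall>\<^sub>F T in at_right 0. \<forall>c. K * T ^ N * (cmod (c k))\<^sup>2 \<le> exp_energy UNIV e T c"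
      using exp_energy_lower_bound[of "UNIV - {k}" k e] inj_e unfolding N_def by (simp add: insert_absorb)
    then obtain K where K: "K > 0" "\<forall>\<^sub>F T in at_right 0. \<forall>c. K * T ^ N * (cmod (c k))\<^sup>2 \<le> exp_energy UNIV e T c"
      by blast
    from K(2) eventually_at_right_less[of "0::real"] show ?thesis
    proof eventually_elim
      case (elim T)
      show ?case
      proof (intro allI impI)
        fix c :: "'n \<Rightarrow> complex" assume "c k \<noteq> 0"
        then have "0 < K * T ^ N * (cmod (c k))\<^sup>2"
          using K(1) elim(2) by (intro mult_pos_pos) auto
        then show "0 < exp_energy UNIV e T c" using elim(1)[rule_format, of c] by linarith
      qed
    qed
  qed
  then have "\<forall>\<^sub>F T in at_right 0. \<forall>k. \<forall>c. c k \<noteq> 0 \<longrightarrow> 0 < exp_energy UNIV e T c"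
    by (rule eventually_all_finite)
  then show ?thesis by (rule eventually_mono) blast
qed

lemma coord_of_weights:
  assumes "\<And>k. p k \<ge> 0" "\<And>k. p (sg k) = p k" "(\<Sum>k\<in>UNIV. p k) = 1"
  shows "\<exists>b. norm b = 1 \<and> (\<forall>k. coord b k = of_real (sqrt (p k)))"
proof -
  obtain b where b: "coord b = (\<lambda>k. of_real (sqrt (p k)))"
    using coord_surj[of "\<lambda>k. of_real (sqrt (p k))"] assms(2) by (auto simp: conj_sym_def)
  then have "b \<bullet> b = 1" using assms by (simp add: parseval_norm)
  then show ?thesis using b by (auto simp: norm_eq_1)
qed

lemma gamma1_positive:
  assumes pos: "\<And>c. \<exists>k. c k \<noteq> 0 \<Longrightarrow> 0 < exp_energy UNIV e T c"
  shows "0 < gamma1 A T"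
proof -
  \<comment> \<open>With equal weights every coordinate of \<open>b\<close> is nonzero, so a nonzero
    \<open>y\<close> cannot have zero response.\<close>
  obtain b where b: "norm b = 1" "\<And>k. coord b k = of_real (sqrt (1 / real CARD('n)))"
    using coord_of_weights[of "\<lambda>_. 1 / real CARD('n)"] by auto
  obtain y where y: "norm y = 1" "exp_energy UNIV e T (response b y) = lambda_min (gramian T A b)"
    using lambda_min_attained by blast
  have "\<exists>k. coord y k \<noteq> 0"
  proof (rule ccontr)
    assume "\<nexists>k. coord y k \<noteq> 0"
    then have "y \<bullet> y = 0" by (simp add: parseval_norm)
    then show False using y(1) by simp
  qed
  then have "\<exists>k. response b y k \<noteq> 0" using b(2) by (auto simp: response_def)
  then show ?thesis using pos y(2) lambda_min_le_gamma1[OF b(1), of T] by fastforce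
qed

lemma maximiser_coord_nonzero:
  assumes "0 < lambda_min (gramian T A b)"
  shows "coord b k \<noteq> 0"
proof
  assume k: "coord b k = 0"
  \<comment> \<open>The test vector lives on the index \<open>k\<close>, joined with
    \<open>sg k\<close> to be real; \<open>coord b\<close> vanishes at both indices, so the response
    is zero.\<close>
  have "conj_sym (\<lambda>j. if j = k \<or> j = sg k then 1 else 0)"
    by (auto simp: conj_sym_def) (metis sg_sg)+
  then obtain x where x: "coord x = (\<lambda>j. if j = k \<or> j = sg k then 1 else 0)" using coord_surj by blast
  have "response b x = (\<lambda>j. 0)" using k by (auto simp: response_def x coord_sg fun_eq_iff)
  then have "exp_energy UNIV e T (response b x) = 0" by (simp add: exp_energy_def exp_sum_def)
  moreover have "x \<bullet> x > 0"
  proof -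
    have "coord x k \<noteq> 0" by (simp add: x)
    then have "x \<noteq> 0" by (auto simp: coord_def)
    then show ?thesis by simp
  qed
  ultimately show False
    using lambda_min_le_energy[of T b x] mult_pos_pos[OF assms, of "x \<bullet> x"] by linarith
qed

text \<open>The vector whose weights are the mean of those of \<open>b1\<close> and \<open>b2\<close> would otherwise beat both,
  by strict convexity of \<open>1 / p\<close>.\<close>

lemma maximiser_weights_unique:
  assumes nonvanishing: "\<And>p \<mu> c. \<lbrakk>\<And>k. 0 < p k;
      \<mu> * (\<Sum>k\<in>UNIV. (cmod (lagrange_weight UNIV e k))\<^sup>2 / p k) \<le> exp_energy UNIV e T (lagrange_weight UNIV e);
      exp_energy UNIV e T c = \<mu> * (\<Sum>k\<in>UNIV. (cmod (c k))\<^sup>2 / p k); \<exists>k. c k \<noteq> 0\<rbrakk> \<Longrightarrow> \<forall>k. c k \<noteq> 0"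
    and \<gamma>: "0 < gamma1 A T"
    and b1: "norm b1 = 1" "lambda_min (gramian T A b1) = gamma1 A T"
    and b2: "norm b2 = 1" "lambda_min (gramian T A b2) = gamma1 A T"
  shows "cmod (coord b1 k) = cmod (coord b2 k)"
proof -
  define p1 where "p1 k = (cmod (coord b1 k))\<^sup>2" for k
  define p2 where "p2 k = (cmod (coord b2 k))\<^sup>2" for k
  define p where "p k = (p1 k + p2 k) / 2" for k
  have nz: "coord b1 k \<noteq> 0" "coord b2 k \<noteq> 0" for k
    using maximiser_coord_nonzero \<gamma> b1 b2 by metis+
  then have pos: "p1 k > 0" "p2 k > 0" "p k > 0" for k by (auto simp: p1_def p2_def p_def add_pos_pos)
  have "sum p1 UNIV = 1" "sum p2 UNIV = 1"
    using b1(1) b2(1) parseval_norm[of b1] parseval_norm[of b2] by (simp_all add: p1_def p2_def norm_eq_1)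
  then have "sum p UNIV = 1"
    by (simp add: p_def add_divide_distrib sum.distrib sum_divide_distrib[symmetric])
  then obtain b where b: "norm b = 1" "\<And>k. coord b k = of_real (sqrt (p k))"
    using coord_of_weights[of p] pos(3) by (auto simp: less_imp_le p_def p1_def p2_def coord_sg)
  have bp: "(cmod (coord b k))\<^sup>2 = p k" "coord b k \<noteq> 0" for k
    using pos(3)[of k] by (simp_all add: b(2))
  define \<mu> where "\<mu> = lambda_min (gramian T A b)"
  obtain y where y: "norm y = 1" "exp_energy UNIV e T (response b y) = \<mu>"
    using lambda_min_attained unfolding \<mu>_def by blast
  define c where "c = response b y"
  have cc: "conj_sym c" unfolding c_def by (rule conj_sym_response)
  have "(cmod (c k))\<^sup>2 / p k = (cmod (coord y k))\<^sup>2" for k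
    using pos(3)[of k] by (simp add: c_def response_def norm_mult power_mult_distrib bp(1))
  then have c1: "(\<Sum>k\<in>UNIV. (cmod (c k))\<^sup>2 / p k) = 1"
    using y(1) parseval_norm[of y] by (simp add: norm_eq_1)
  have c0: "\<forall>k. c k \<noteq> 0"
  proof (rule nonvanishing[of p \<mu>])
    show "\<mu> * (\<Sum>k\<in>UNIV. (cmod (lagrange_weight UNIV e k))\<^sup>2 / p k) \<le> exp_energy UNIV e T (lagrange_weight UNIV e)"
      using lambda_min_le_weighted[OF conj_sym_lagrange_weight bp(2), of T] unfolding bp(1) \<mu>_def .
    show "exp_energy UNIV e T c = \<mu> * (\<Sum>k\<in>UNIV. (cmod (c k))\<^sup>2 / p k)"
      using y(2) c1 by (simp add: c_def)
    show "\<exists>k. c k \<noteq> 0"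
    proof (rule ccontr)
      assume "\<nexists>k. c k \<noteq> 0"
      then show False using c1 by simp
    qed
  qed (rule pos(3))
  \<comment> \<open>The minimising \<open>c\<close> of the mean weights is tested against
    \<open>b1\<close> and \<open>b2\<close>. With \<open>\<mu> \<le> gamma1 A T\<close> the two
    weighted sums average to at most 1, the value for \<open>p\<close>.\<close>
  have "gamma1 A T * (\<Sum>k\<in>UNIV. (cmod (c k))\<^sup>2 / p1 k) \<le> \<mu>"
    using lambda_min_le_weighted[OF cc nz(1), of T] y(2) unfolding b1(2) p1_def c_def by simp
  moreover have "gamma1 A T * (\<Sum>k\<in>UNIV. (cmod (c k))\<^sup>2 / p2 k) \<le> \<mu>"
    using lambda_min_le_weighted[OF cc nz(2), of T] y(2) unfolding b2(2) p2_def c_def by simp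
  moreover have "\<mu> \<le> gamma1 A T" unfolding \<mu>_def by (rule lambda_min_le_gamma1[OF b(1)])
  ultimately have "gamma1 A T * ((\<Sum>k\<in>UNIV. (cmod (c k))\<^sup>2 / p1 k) + (\<Sum>k\<in>UNIV. (cmod (c k))\<^sup>2 / p2 k)) \<le> gamma1 A T * 2"
    by (simp add: distrib_left)
  then have "(\<Sum>k\<in>UNIV. (cmod (c k))\<^sup>2 / p1 k) + (\<Sum>k\<in>UNIV. (cmod (c k))\<^sup>2 / p2 k) \<le> 2 * (\<Sum>k\<in>UNIV. (cmod (c k))\<^sup>2 / p k)"
    using \<gamma> c1 by (simp add: mult_le_cancel_left)
  then have le: "(\<Sum>k\<in>UNIV. (cmod (c k))\<^sup>2 * (1 / p1 k + 1 / p2 k - 2 / p k)) \<le> 0"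
    by (simp add: algebra_simps sum.distrib sum_subtractf sum_distrib_left)
  \<comment> \<open>The midpoint convexity defect of the reciprocal, written as a square over a
    positive denominator: it vanishes only when the two weights agree.\<close>
  have gap: "1 / p1 k + 1 / p2 k - 2 / p k = (p1 k - p2 k)\<^sup>2 / (p1 k * p2 k * (p1 k + p2 k))" for k
  proof -
    have "p1 k \<noteq> 0" "p2 k \<noteq> 0" "p1 k + p2 k \<noteq> 0" using pos[of k] by (auto simp: add_eq_0_iff)
    then show ?thesis by (simp add: p_def divide_simps) (simp add: algebra_simps power2_eq_square)
  qed
  have ge: "0 \<le> (cmod (c k))\<^sup>2 * (1 / p1 k + 1 / p2 k - 2 / p k)" for k
    unfolding gap using pos[of k] by (auto intro!: mult_nonneg_nonneg divide_nonneg_nonneg)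
  have "(cmod (c k))\<^sup>2 * (1 / p1 k + 1 / p2 k - 2 / p k) = 0"
  proof -
    have "(\<Sum>k\<in>UNIV. (cmod (c k))\<^sup>2 * (1 / p1 k + 1 / p2 k - 2 / p k)) = 0"
      using le sum_nonneg[of UNIV "\<lambda>k. (cmod (c k))\<^sup>2 * (1 / p1 k + 1 / p2 k - 2 / p k)", OF ge] by linarith
    then show ?thesis using ge by (subst (asm) sum_nonneg_eq_0_iff) auto
  qed
  then have "1 / p1 k + 1 / p2 k - 2 / p k = 0" using c0 by simp
  then have "(p1 k - p2 k)\<^sup>2 = 0" unfolding gap using pos[of k] by auto
  then show ?thesis by (simp add: p1_def p2_def)
qed

section \<open>Maximisers as an orbit of the centralizer\<close>

lemma response_fun_mat:
  assumes "conj_sym \<phi>"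
  shows "response (fun_mat \<phi> *v b) x = response b (fun_mat (\<lambda>k. cnj (\<phi> k)) *v x)"
proof -
  have "conj_sym (\<lambda>k. cnj (\<phi> k))" using assms by (simp add: conj_sym_def)
  then show ?thesis by (simp add: response_def fun_eq_iff coord_fun_mat assms)
qed

lemma norm_fun_mat:
  assumes "conj_sym \<phi>" "\<And>k. cmod (\<phi> k) = 1"
  shows "norm (fun_mat \<phi> *v x) = norm x"
  by (simp add: norm_eq parseval_norm coord_fun_mat assms norm_mult)

text \<open>The adjoint of \<open>fun_mat \<phi>\<close> moves onto the minimising test vector and
  preserves its norm. One inequality suffices: for a maximiser \<open>b\<close> the reverse one is
  maximality.\<close>

lemma lambda_min_le_fun_mat:
  assumes "conj_sym \<phi>" "\<And>k. cmod (\<phi> k) = 1"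
  shows "lambda_min (gramian T A b) \<le> lambda_min (gramian T A (fun_mat \<phi> *v b))"
proof -
  obtain y where y: "norm y = 1"
      "exp_energy UNIV e T (response (fun_mat \<phi> *v b) y) = lambda_min (gramian T A (fun_mat \<phi> *v b))"
    using lambda_min_attained by blast
  let ?z = "fun_mat (\<lambda>k. cnj (\<phi> k)) *v y"
  have "norm ?z = 1" using y(1) assms by (subst norm_fun_mat) (auto simp: conj_sym_def)
  then show ?thesis
    using lambda_min_le_energy[of T b ?z] y(2) by (simp add: norm_eq_1 response_fun_mat[OF assms(1)])
qed

text \<open>Positivity of \<open>gamma1\<close> is carried along because it makes all coordinates of
  a maximiser nonzero, which the quotient \<open>\<phi>\<close> in the proof and the later count
  both rely on.\<close>

lemma maximisers_orbit:
  "\<forall>\<^sub>F T in at_right 0. 0 < gamma1 A T \<and> (\<forall>b0. norm b0 = 1 \<and> lambda_min (gramian T A b0) = gamma1 A T \<longrightarrow>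
     {b. norm b = 1 \<and> lambda_min (gramian T A b) = gamma1 A T} =
     {R *v b0 | R. R \<in> carrier (orthogonal_centralizer A)})"
  using minimiser_coefficient_nonzero[OF finite inj_e] energy_positive
proof eventually_elim
  case (elim T)
  have \<gamma>: "0 < gamma1 A T" using elim(2) by (intro gamma1_positive) blast
  have nonvanishing: "\<lbrakk>\<And>k. 0 < p k;
      \<mu> * (\<Sum>k\<in>UNIV. (cmod (lagrange_weight UNIV e k))\<^sup>2 / p k) \<le> exp_energy UNIV e T (lagrange_weight UNIV e);
      exp_energy UNIV e T c = \<mu> * (\<Sum>k\<in>UNIV. (cmod (c k))\<^sup>2 / p k); \<exists>k. c k \<noteq> 0\<rbrakk> \<Longrightarrow> \<forall>k. c k \<noteq> 0" for p \<mu> c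
    by (rule elim(1)[THEN spec, THEN spec, THEN spec, THEN mp, THEN mp, THEN mp, THEN mp, THEN bspec, of p \<mu> c, THEN allI]) auto
  show ?case
  proof (intro conjI allI impI Set.set_eqI iffI)
    fix b0 b
    assume b0: "norm b0 = 1 \<and> lambda_min (gramian T A b0) = gamma1 A T"
      and "b \<in> {b. norm b = 1 \<and> lambda_min (gramian T A b) = gamma1 A T}"
    then have b: "norm b = 1" "lambda_min (gramian T A b) = gamma1 A T" by auto
    have nz: "coord b0 k \<noteq> 0" for k using maximiser_coord_nonzero \<gamma> b0 by metis
    define \<phi> where "\<phi> k = coord b k / coord b0 k" for k
    have cs: "conj_sym \<phi>" by (simp add: conj_sym_def \<phi>_def coord_sg)
    have "cmod (coord b k) = cmod (coord b0 k)" for k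
      using b b0 by (intro maximiser_weights_unique[OF nonvanishing \<gamma>]) auto
    then have "\<forall>k. cmod (\<phi> k) = 1" using nz by (simp add: \<phi>_def norm_divide)
    then have "fun_mat \<phi> \<in> carrier (orthogonal_centralizer A)"
      unfolding orthogonal_centralizer_eq using cs by blast
    moreover have "b = fun_mat \<phi> *v b0"
      by (rule coord_inject) (use nz in \<open>simp add: fun_eq_iff coord_fun_mat[OF cs] \<phi>_def\<close>)
    ultimately show "b \<in> {R *v b0 | R. R \<in> carrier (orthogonal_centralizer A)}" by blast
  next
    fix b0 b
    assume b0: "norm b0 = 1 \<and> lambda_min (gramian T A b0) = gamma1 A T"
      and "b \<in> {R *v b0 | R. R \<in> carrier (orthogonal_centralizer A)}"
    then obtain \<phi> where \<phi>: "b = fun_mat \<phi> *v b0" "conj_sym \<phi>" "\<And>k. cmod (\<phi> k) = 1"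
      unfolding orthogonal_centralizer_eq by blast
    have "norm b = 1" using b0 by (simp add: \<phi> norm_fun_mat)
    moreover from this have "lambda_min (gramian T A b) = gamma1 A T"
      using lambda_min_le_gamma1[of b T] lambda_min_le_fun_mat[OF \<phi>(2,3), of T b0] b0 \<phi>(1) by simp
    ultimately show "b \<in> {b. norm b = 1 \<and> lambda_min (gramian T A b) = gamma1 A T}" by simp
  qed (rule \<gamma>)
qed

end

subsection \<open>The orthogonal centralizer\<close>

lemma Hausdorff_space_top_of_set: "Hausdorff_space (top_of_set (S :: 'a::t2_space set))"
proof (rule Hausdorff_space_subtopology)
  show "Hausdorff_space (euclidean :: 'a topology)"
    unfolding Hausdorff_space_def disjnt_def open_openin[symmetric] by (intro allI impI, rule hausdorff) simp
qed

lemma orthogonal_matrices_bounded: "bounded {R :: real^'n^'n. orthogonal_matrix R}"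
proof -
  have "norm R \<le> real CARD('n)" if "orthogonal_matrix R" for R :: "real^'n^'n"
  proof -
    have row: "norm (R $ i) = 1" for i
    proof -
      have "(R ** transpose R) $ i $ i = 1"
        using that by (simp add: orthogonal_matrix_def mat_def)
      then have "(R $ i) \<bullet> (R $ i) = 1"
        by (simp add: matrix_matrix_mult_def transpose_def inner_vec_def)
      then show ?thesis by (simp add: norm_eq_1)
    qed
    have "norm R \<le> (\<Sum>i\<in>UNIV. norm (R $ i))"
      unfolding norm_vec_def[of R] by (rule L2_set_le_sum) simp
    then show ?thesis by (simp add: row)
  qed
  then show ?thesis by (auto simp: bounded_iff)
qed

lemma continuous_on_matrix_mult:
  fixes f g :: "'b::topological_space \<Rightarrow> real^'n^'n"
  assumes "continuous_on X f" "continuous_on X g"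
  shows "continuous_on X (\<lambda>x. f x ** g x)"
  unfolding matrix_matrix_mult_def
  by (rule continuous_on_vec_lambda, rule continuous_on_vec_lambda, rule continuous_on_sum, rule continuous_on_mult)
     (rule continuous_on_component, rule continuous_on_component, rule assms)+

lemma continuous_on_transpose: "continuous_on X (transpose :: real^'n^'n \<Rightarrow> real^'n^'n)"
  unfolding transpose_def
  by (rule continuous_on_vec_lambda, rule continuous_on_vec_lambda, rule continuous_on_component,
      rule continuous_on_component, rule continuous_on_id)

text \<open>The set is cut out by continuous equations and bounded because orthogonal matrices have
  unit rows.\<close>

lemma compact_orthogonal_centralizer:
  fixes A :: "real^'n^'n"
  shows "compact (carrier (orthogonal_centralizer A))"
proof -
  let ?C = "{R :: real^'n^'n. orthogonal_matrix R \<and> R ** A = A ** R}"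
  have "?C = {R. transpose R ** R = mat 1} \<inter> {R. R ** A = A ** R}"
    unfolding orthogonal_matrix by (rule Collect_conj_eq)
  moreover have "closed {R :: real^'n^'n. transpose R ** R = mat 1}"
    by (rule closed_Collect_eq)
       (rule continuous_on_matrix_mult continuous_on_transpose continuous_on_id continuous_on_const)+
  moreover have "closed {R :: real^'n^'n. R ** A = A ** R}"
    by (rule closed_Collect_eq) (rule continuous_on_matrix_mult continuous_on_id continuous_on_const)+
  ultimately have "closed ?C" by (simp only: closed_Int)
  moreover have "bounded ?C" by (rule bounded_subset[OF orthogonal_matrices_bounded]) auto
  ultimately show ?thesis by (simp add: orthogonal_centralizer_def compact_eq_bounded_closed)
qed

section \<open>The isomorphism with signs and circles\<close>

context eigenframe
begin

text \<open>Reads off the symbol of \<open>R\<close> at the real eigenvalues, listed by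
  \<open>\<alpha>\<close>, and at one member of each conjugate pair, listed by
  \<open>\<beta>\<close>. The conditional turns the complex values 1 and -1 into the integers of
  \<open>sign_img\<close>.\<close>

definition spectral_signs :: "nat \<Rightarrow> (nat \<Rightarrow> 'n) \<Rightarrow> nat \<Rightarrow> (nat \<Rightarrow> 'n) \<Rightarrow> real^'n^'n \<Rightarrow> (nat \<Rightarrow> int) \<times> (nat \<Rightarrow> complex)" where
  "spectral_signs r \<alpha> q \<beta> R =
     (\<lambda>i\<in>{..<r}. if matrix_coord R (\<alpha> i) (\<alpha> i) = 1 then 1 else -1,
      \<lambda>j\<in>{..<q}. matrix_coord R (\<beta> j) (\<beta> j))"

lemma sg_eq_iff: "sg k = k \<longleftrightarrow> Im (e k) = 0"
proof -
  have "sg k = k \<longleftrightarrow> e (sg k) = e k" using inj_e by (auto simp: inj_on_def)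
  then show ?thesis by (simp add: e_sg complex_eq_iff)
qed

lemma centralizerE:
  assumes "R \<in> carrier (orthogonal_centralizer A)"
  obtains \<phi> where "R = fun_mat \<phi>" "conj_sym \<phi>" "\<And>k. cmod (\<phi> k) = 1"
  using assms unfolding orthogonal_centralizer_eq by blast

lemma real_symbol:
  assumes "conj_sym \<phi>" "cmod (\<phi> k) = 1" "Im (e k) = 0"
  shows "\<phi> k = 1 \<or> \<phi> k = -1"
proof -
  have "cnj (\<phi> k) = \<phi> k" using conj_symD[OF assms(1), of k] assms(3) by (simp add: sg_eq_iff[symmetric])
  then have "\<phi> k = of_real (Re (\<phi> k))" by (simp add: complex_eq_iff)
  moreover from this have "\<bar>Re (\<phi> k)\<bar> = 1" using assms(2) by (metis norm_of_real)
  ultimately show ?thesis by (metis abs_if add.inverse_inverse of_real_1 of_real_minus)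
qed

lemma spectral_signs_continuous:
  assumes "\<alpha> ` {..<r} \<subseteq> {k. Im (e k) = 0}"
  shows "continuous_map (top_of_set (carrier (orthogonal_centralizer A))) (sign_circle_topology r q) (spectral_signs r \<alpha> q \<beta>)"
proof -
  let ?C = "carrier (orthogonal_centralizer A)"
  have mc: "continuous_on X (\<lambda>R. matrix_coord R k k)" for X k
    unfolding matrix_coord_def cinner_def matrix_vector_mult_def map_matrix_def vec_lambda_beta
    by (intro continuous_intros)
  have s: "continuous_on ?C (\<lambda>R. if matrix_coord R (\<alpha> i) (\<alpha> i) = 1 then 1 else - 1 :: int)" if i: "i < r" for i
  proof -
    \<comment> \<open>On the centralizer this entry takes values in a finite, hence discrete, set,
      so the conditional composed with it is continuous.\<close>
    have "(\<lambda>R. matrix_coord R (\<alpha> i) (\<alpha> i)) ` ?C \<subseteq> {1, -1}"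
    proof (rule image_subsetI)
      fix R assume "R \<in> ?C"
      then obtain \<phi> where \<phi>: "R = fun_mat \<phi>" "conj_sym \<phi>" "\<And>k. cmod (\<phi> k) = 1" using centralizerE by blast
      have "Im (e (\<alpha> i)) = 0" using assms i by auto
      then show "matrix_coord R (\<alpha> i) (\<alpha> i) \<in> {1, -1}"
        using real_symbol[OF \<phi>(2,3)] by (simp add: \<phi>(1) matrix_coord_fun_mat[OF \<phi>(2)])
    qed
    then show ?thesis
      using continuous_on_compose2[OF continuous_on_finite[of "{1, -1}" "\<lambda>z :: complex. if z = 1 then 1 else - 1 :: int"] mc]
      by simp
  qed
  have c: "cmod (matrix_coord R k k) = 1" if R: "R \<in> ?C" for R k
  proof -
    obtain \<phi> where \<phi>: "R = fun_mat \<phi>" "conj_sym \<phi>" "\<And>k. cmod (\<phi> k) = 1" using centralizerE[OF R] by blast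
    then show ?thesis by (simp add: matrix_coord_fun_mat)
  qed
  have "continuous_map (top_of_set ?C) (top_of_set (carrier sign_img)) (\<lambda>R. fst (spectral_signs r \<alpha> q \<beta> R) i)"
    if i: "i < r" for i
    unfolding continuous_map_subtopology_eu using s[OF i] i by (simp add: spectral_signs_def sign_img_def)
  moreover have "continuous_map (top_of_set ?C) (top_of_set (carrier circle_group)) (\<lambda>R. snd (spectral_signs r \<alpha> q \<beta> R) j)"
    if j: "j < q" for j
    unfolding continuous_map_subtopology_eu using mc j c by (simp add: spectral_signs_def circle_group_def Pi_def)
  ultimately show ?thesis
    unfolding sign_circle_topology_def continuous_map_pairwise continuous_map_componentwise
    by (simp add: o_def image_subset_iff) (simp add: spectral_signs_def)
qed

lemma spectral_signs_mult:
  assumes "\<alpha> ` {..<r} \<subseteq> {k. Im (e k) = 0}"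
    and R: "R \<in> carrier (orthogonal_centralizer A)" and S: "S \<in> carrier (orthogonal_centralizer A)"
  shows "spectral_signs r \<alpha> q \<beta> (R ** S) =
    spectral_signs r \<alpha> q \<beta> R \<otimes>\<^bsub>sign_circle_group r q\<^esub> spectral_signs r \<alpha> q \<beta> S"
proof -
  obtain \<phi> where \<phi>: "R = fun_mat \<phi>" "conj_sym \<phi>" "\<And>k. cmod (\<phi> k) = 1" using centralizerE[OF R] by blast
  obtain \<psi> where \<psi>: "S = fun_mat \<psi>" "conj_sym \<psi>" "\<And>k. cmod (\<psi> k) = 1" using centralizerE[OF S] by blast
  have cs: "conj_sym (\<lambda>k. \<phi> k * \<psi> k)" using \<phi> \<psi> by (simp add: conj_sym_def)
  have sgn: "\<phi> (\<alpha> i) = 1 \<or> \<phi> (\<alpha> i) = -1" "\<psi> (\<alpha> i) = 1 \<or> \<psi> (\<alpha> i) = -1" if "i < r" for i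
    using real_symbol[OF \<phi>(2,3)] real_symbol[OF \<psi>(2,3)] assms(1) that by auto
  have "(if \<phi> (\<alpha> i) * \<psi> (\<alpha> i) = 1 then 1 else - 1 :: int) = (if \<phi> (\<alpha> i) = 1 then 1 else - 1) * (if \<psi> (\<alpha> i) = 1 then 1 else - 1)"
    if "i < r" for i using sgn[OF that] by auto
  then show ?thesis
    by (simp add: \<phi>(1) \<psi>(1) fun_mat_mult \<phi>(2) \<psi>(2) spectral_signs_def matrix_coord_fun_mat cs
        sign_circle_group_def sign_img_def circle_group_def restrict_def fun_eq_iff)
qed

lemma spectral_signs_bij:
  assumes \<alpha>: "bij_betw \<alpha> {..<r} {k. Im (e k) = 0}" and \<beta>: "bij_betw \<beta> {..<q} {k. 0 < Im (e k)}"
  shows "bij_betw (spectral_signs r \<alpha> q \<beta>) (carrier (orthogonal_centralizer A)) (carrier (sign_circle_group r q))"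
proof (rule bij_betw_imageI)
  let ?f = "spectral_signs r \<alpha> q \<beta>"
  have \<alpha>r: "\<alpha> i \<in> {k. Im (e k) = 0}" if "i < r" for i using \<alpha> that by (auto simp: bij_betw_def)
  show "inj_on ?f (carrier (orthogonal_centralizer A))"
  proof (rule inj_onI)
    fix R S
    assume R: "R \<in> carrier (orthogonal_centralizer A)" and S: "S \<in> carrier (orthogonal_centralizer A)"
      and eq: "?f R = ?f S"
    obtain \<phi> where \<phi>: "R = fun_mat \<phi>" "conj_sym \<phi>" "\<And>k. cmod (\<phi> k) = 1" using centralizerE[OF R] by blast
    obtain \<psi> where \<psi>: "S = fun_mat \<psi>" "conj_sym \<psi>" "\<And>k. cmod (\<psi> k) = 1" using centralizerE[OF S] by blast
    have eqr: "(if \<phi> (\<alpha> i) = 1 then 1 else - 1 :: int) = (if \<psi> (\<alpha> i) = 1 then 1 else - 1)" if "i < r" for i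
    proof -
      have "fst (?f R) i = fst (?f S) i" using eq by simp
      then show ?thesis using that by (simp add: spectral_signs_def \<phi>(1) \<psi>(1) matrix_coord_fun_mat \<phi>(2) \<psi>(2))
    qed
    have eqc: "\<phi> (\<beta> j) = \<psi> (\<beta> j)" if "j < q" for j
    proof -
      have "snd (?f R) j = snd (?f S) j" using eq by simp
      then show ?thesis using that by (simp add: spectral_signs_def \<phi>(1) \<psi>(1) matrix_coord_fun_mat \<phi>(2) \<psi>(2))
    qed
    have up: "\<phi> k = \<psi> k" if k: "0 < Im (e k)" for k
    proof -
      have "k \<in> \<beta> ` {..<q}" using \<beta> k by (simp add: bij_betw_def)
      then obtain j where "j < q" "k = \<beta> j" by blast
      then show ?thesis using eqc by simp
    qed
    have "\<phi> k = \<psi> k" for k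
    proof (cases "Im (e k)" "0 :: real" rule: linorder_cases)
      case less
      then have "\<phi> (sg k) = \<psi> (sg k)" by (intro up) (simp add: e_sg)
      then show ?thesis using \<phi>(2) \<psi>(2) by (simp add: conj_sym_def)
    next
      case equal
      then have "k \<in> \<alpha> ` {..<r}" using \<alpha> by (simp add: bij_betw_def)
      then obtain i where i: "i < r" "k = \<alpha> i" by blast
      then have "(\<phi> k = 1) = (\<psi> k = 1)" using eqr[OF i(1)] by (simp split: if_splits)
      then show ?thesis
        using real_symbol[OF \<phi>(2,3) equal] real_symbol[OF \<psi>(2,3) equal] by metis
    qed (rule up)
    then have "\<phi> = \<psi>" by (simp add: fun_eq_iff)
    then show "R = S" using \<phi>(1) \<psi>(1) by simp
  qed
  show "?f ` carrier (orthogonal_centralizer A) = carrier (sign_circle_group r q)"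
  proof (rule Set.set_eqI, rule iffI)
    fix y assume "y \<in> ?f ` carrier (orthogonal_centralizer A)"
    then obtain R where R: "R \<in> carrier (orthogonal_centralizer A)" "y = ?f R" by blast
    obtain \<phi> where \<phi>: "R = fun_mat \<phi>" "conj_sym \<phi>" "\<And>k. cmod (\<phi> k) = 1" using centralizerE[OF R(1)] by blast
    show "y \<in> carrier (sign_circle_group r q)"
      by (simp add: R(2) spectral_signs_def \<phi>(1,3) matrix_coord_fun_mat[OF \<phi>(2)] sign_circle_group_def
          sign_img_def circle_group_def)
  next
    fix y assume y: "y \<in> carrier (sign_circle_group r q)"
    obtain s u where su: "y = (s, u)" by (cases y)
    have sP: "s \<in> {..<r} \<rightarrow>\<^sub>E {-1, 1}" and uP: "u \<in> {..<q} \<rightarrow>\<^sub>E {z. cmod z = 1}"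
      using y by (simp_all add: su sign_circle_group_def sign_img_def circle_group_def)
    have s: "\<not> i < r \<Longrightarrow> s i = undefined" "i < r \<Longrightarrow> s i = 1 \<or> s i = -1" for i
      using PiE_arb[OF sP, of i] PiE_mem[OF sP, of i] by simp_all blast
    have u: "\<not> j < q \<Longrightarrow> u j = undefined" "j < q \<Longrightarrow> cmod (u j) = 1" for j
      using PiE_arb[OF uP, of j] PiE_mem[OF uP, of j] by simp_all
    define \<alpha>' where "\<alpha>' = inv_into {..<r} \<alpha>"
    define \<beta>' where "\<beta>' = inv_into {..<q} \<beta>"
    have \<alpha>': "\<alpha>' k < r" if "Im (e k) = 0" for k
    proof -
      have "k \<in> \<alpha> ` {..<r}" using \<alpha> that by (simp add: bij_betw_def)
      then show ?thesis using inv_into_into[of k \<alpha> "{..<r}"] by (simp add: \<alpha>'_def)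
    qed
    have \<beta>': "\<beta>' k < q" if "0 < Im (e k)" for k
    proof -
      have "k \<in> \<beta> ` {..<q}" using \<beta> that by (simp add: bij_betw_def)
      then show ?thesis using inv_into_into[of k \<beta> "{..<q}"] by (simp add: \<beta>'_def)
    qed
    have inv: "i < r \<Longrightarrow> \<alpha>' (\<alpha> i) = i" "j < q \<Longrightarrow> \<beta>' (\<beta> j) = j" for i j
      using \<alpha> \<beta> by (simp_all add: \<alpha>'_def \<beta>'_def bij_betw_def inv_into_f_f)
    \<comment> \<open>Prescribed at real and upper half-plane eigenvalues and extended to the lower
      half-plane by conjugation, so that the matrix is real.\<close>
    define \<phi> where "\<phi> k = (if Im (e k) = 0 then of_int (s (\<alpha>' k)) else if 0 < Im (e k) then u (\<beta>' k) else cnj (u (\<beta>' (sg k))))" for k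
    have cs: "conj_sym \<phi>"
      unfolding conj_sym_def
    proof
      fix k
      show "\<phi> (sg k) = cnj (\<phi> k)"
      proof (cases "Im (e k)" "0 :: real" rule: linorder_cases)
        case equal
        then have "sg k = k" by (simp add: sg_eq_iff)
        then show ?thesis using equal by (simp add: \<phi>_def)
      qed (simp_all add: \<phi>_def e_sg)
    qed
    have n: "cmod (\<phi> k) = 1" for k
    proof (cases "Im (e k)" "0 :: real" rule: linorder_cases)
      case less
      then show ?thesis using u(2)[OF \<beta>'[of "sg k"]] by (simp add: \<phi>_def e_sg)
    next
      case equal
      then show ?thesis using s(2)[OF \<alpha>'[OF equal]] by (auto simp: \<phi>_def)
    next
      case greater
      then show ?thesis using u(2)[OF \<beta>'[OF greater]] by (simp add: \<phi>_def)
    qed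
    have a: "\<phi> (\<alpha> i) = of_int (s i)" if "i < r" for i
      using \<alpha>r[OF that] inv(1)[OF that] by (simp add: \<phi>_def)
    have b: "\<phi> (\<beta> j) = u j" if "j < q" for j
    proof -
      have "0 < Im (e (\<beta> j))" using \<beta> that by (auto simp: bij_betw_def)
      then show ?thesis using inv(2)[OF that] by (simp add: \<phi>_def)
    qed
    have "fst (?f (fun_mat \<phi>)) i = s i" for i
    proof (cases "i < r")
      case True
      then show ?thesis using a[OF True] s(2)[OF True]
        by (auto simp: spectral_signs_def matrix_coord_fun_mat[OF cs])
    qed (simp add: spectral_signs_def s(1))
    moreover have "snd (?f (fun_mat \<phi>)) j = u j" for j
    proof (cases "j < q")
      case True
      then show ?thesis using b[OF True]
        by (simp add: spectral_signs_def matrix_coord_fun_mat[OF cs])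
    qed (simp add: spectral_signs_def u(1))
    ultimately have "?f (fun_mat \<phi>) = y" by (simp add: su prod_eq_iff fun_eq_iff)
    moreover have "fun_mat \<phi> \<in> carrier (orthogonal_centralizer A)"
      unfolding orthogonal_centralizer_eq using cs n by blast
    ultimately show "y \<in> ?f ` carrier (orthogonal_centralizer A)" by blast
  qed
qed

lemma topspace_sign_circle: "topspace (sign_circle_topology r q) = carrier (sign_circle_group r q)"
  by (simp add: sign_circle_topology_def sign_circle_group_def)

lemma Hausdorff_sign_circle: "Hausdorff_space (sign_circle_topology r q)"
  unfolding sign_circle_topology_def Hausdorff_space_prod_topology Hausdorff_space_product_topology
  by (simp add: Hausdorff_space_top_of_set)

lemma card_real_indices: "card {z \<in> complex_spectrum A. z \<in> \<real>} = card {k. Im (e k) = 0}"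
proof -
  have "{z \<in> complex_spectrum A. z \<in> \<real>} = e ` {k. Im (e k) = 0}"
    by (auto simp: range_e[symmetric] complex_is_Real_iff)
  then show ?thesis using inj_e by (simp add: card_image inj_on_subset)
qed

text \<open>Each nonreal pair has exactly one member in the upper half-plane, which serves as its
  representative.\<close>

lemma card_conjugate_pairs: "card {{z, cnj z} | z. z \<in> complex_spectrum A \<and> z \<notin> \<real>} = card {k. 0 < Im (e k)}"
proof -
  let ?g = "\<lambda>k. {e k, cnj (e k)}"
  have "{{z, cnj z} | z. z \<in> complex_spectrum A \<and> z \<notin> \<real>} = ?g ` {k. 0 < Im (e k)}"
  proof (rule Set.set_eqI, rule iffI)
    fix X assume "X \<in> {{z, cnj z} | z. z \<in> complex_spectrum A \<and> z \<notin> \<real>}"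
    then obtain k where k: "X = ?g k" "Im (e k) \<noteq> 0"
      by (auto simp: range_e[symmetric] complex_is_Real_iff)
    show "X \<in> ?g ` {k. 0 < Im (e k)}"
    proof (cases "0 < Im (e k)")
      case False
      then have "X = ?g (sg k)" "0 < Im (e (sg k))" using k by (auto simp: e_sg)
      then show ?thesis by blast
    qed (use k in auto)
  next
    fix X assume "X \<in> ?g ` {k. 0 < Im (e k)}"
    then show "X \<in> {{z, cnj z} | z. z \<in> complex_spectrum A \<and> z \<notin> \<real>}"
      by (auto simp: range_e[symmetric] complex_is_Real_iff)
  qed
  moreover have "inj_on ?g {k. 0 < Im (e k)}"
  proof (rule inj_onI)
    fix k l assume "k \<in> {k. 0 < Im (e k)}" "l \<in> {k. 0 < Im (e k)}" "?g k = ?g l"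
    then have "e k = e l" by (auto simp: doubleton_eq_iff)
    then show "k = l" using inj_e by (auto simp: inj_on_def)
  qed
  ultimately show ?thesis by (simp add: card_image)
qed

lemma orthogonal_centralizer_iso:
  assumes "r = card {z \<in> complex_spectrum A. z \<in> \<real>}"
    and "q = card {{z, cnj z} | z. z \<in> complex_spectrum A \<and> z \<notin> \<real>}"
  shows "\<exists>f. f \<in> iso (orthogonal_centralizer A) (sign_circle_group r q) \<and>
     homeomorphic_map (top_of_set (carrier (orthogonal_centralizer A))) (sign_circle_topology r q) f"
proof -
  obtain \<alpha> where \<alpha>: "bij_betw \<alpha> {..<r} {k. Im (e k) = 0}"
    using ex_bij_betw_nat_finite[of "{k. Im (e k) = 0}"] assms(1)
    by (auto simp: card_real_indices atLeast0LessThan)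
  obtain \<beta> where \<beta>: "bij_betw \<beta> {..<q} {k. 0 < Im (e k)}"
    using ex_bij_betw_nat_finite[of "{k. 0 < Im (e k)}"] assms(2)
    by (auto simp: card_conjugate_pairs atLeast0LessThan)
  let ?f = "spectral_signs r \<alpha> q \<beta>"
  note bij = spectral_signs_bij[OF \<alpha> \<beta>]
  have sub: "\<alpha> ` {..<r} \<subseteq> {k. Im (e k) = 0}" using \<alpha> by (simp add: bij_betw_def)
  have "?f \<in> hom (orthogonal_centralizer A) (sign_circle_group r q)"
  proof (rule homI)
    fix R assume "R \<in> carrier (orthogonal_centralizer A)"
    then show "?f R \<in> carrier (sign_circle_group r q)" using bij by (auto simp: bij_betw_def)
  next
    fix R S assume "R \<in> carrier (orthogonal_centralizer A)" "S \<in> carrier (orthogonal_centralizer A)"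
    then show "?f (R \<otimes>\<^bsub>orthogonal_centralizer A\<^esub> S) = ?f R \<otimes>\<^bsub>sign_circle_group r q\<^esub> ?f S"
      using spectral_signs_mult[OF sub, of R S q \<beta>] by (simp add: orthogonal_centralizer_def)
  qed
  then have "?f \<in> iso (orthogonal_centralizer A) (sign_circle_group r q)"
    using bij by (simp add: iso_def)
  moreover have "homeomorphic_map (top_of_set (carrier (orthogonal_centralizer A))) (sign_circle_topology r q) ?f"
  \<comment> \<open>A continuous bijection from a compact space onto a Hausdorff space is a
    homeomorphism, which settles continuity of the inverse.\<close>
  proof (rule continuous_imp_homeomorphic_map[OF spectral_signs_continuous[OF sub] _ Hausdorff_sign_circle])
    show "compact_space (top_of_set (carrier (orthogonal_centralizer A)))"
      by (simp add: compact_space_subtopology compact_orthogonal_centralizer)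
    show "?f ` topspace (top_of_set (carrier (orthogonal_centralizer A))) = topspace (sign_circle_topology r q)"
      "inj_on ?f (topspace (top_of_set (carrier (orthogonal_centralizer A))))"
      using bij by (simp_all add: topspace_sign_circle bij_betw_def)
  qed
  ultimately show ?thesis by blast
qed

section \<open>Symmetric matrices: counting sign patterns\<close>

lemma symmetric_sg:
  assumes "transpose A = A"
  shows "sg k = k"
proof -
  have "cinner (v k) (e k *s v k) = cinner (v k) (cnj (e k) *s v k)"
    unfolding eigenvector[symmetric] transpose_eigenvector[symmetric] assms ..
  then have "e k = cnj (e k)" by (simp add: cinner_scale_right orthonormal)
  then show ?thesis by (simp add: sg_eq_iff complex_eq_iff)
qed

definition signed :: "real^'n \<Rightarrow> 'n set \<Rightarrow> real^'n" where
  "signed b S = fun_mat (\<lambda>k. if k \<in> S then 1 else -1) *v b"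

context
  assumes sg_id: "\<And>k. sg k = k"
begin

lemma coord_signed: "coord (signed b S) k = (if k \<in> S then coord b k else - coord b k)"
proof -
  have "conj_sym (\<lambda>k. if k \<in> S then 1 else -1)" by (simp add: conj_sym_def sg_id)
  then show ?thesis by (simp add: signed_def coord_fun_mat)
qed

lemma centralizer_orbit_signed:
  "{R *v b | R. R \<in> carrier (orthogonal_centralizer A)} = range (signed b)"
proof (rule Set.set_eqI, rule iffI)
  fix x assume "x \<in> {R *v b | R. R \<in> carrier (orthogonal_centralizer A)}"
  then obtain R where R: "x = R *v b" "R \<in> carrier (orthogonal_centralizer A)" by blast
  obtain \<phi> where \<phi>: "R = fun_mat \<phi>" "conj_sym \<phi>" "\<And>k. cmod (\<phi> k) = 1" using centralizerE[OF R(2)] by blast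
  have "\<phi> k = 1 \<or> \<phi> k = -1" for k
    using real_symbol[OF \<phi>(2,3)] sg_id sg_eq_iff by blast
  then have "\<phi> = (\<lambda>k. if k \<in> {k. \<phi> k = 1} then 1 else -1)" by (auto simp: fun_eq_iff)
  then have "x = signed b {k. \<phi> k = 1}" unfolding signed_def R(1) \<phi>(1) by simp
  then show "x \<in> range (signed b)" by blast
next
  fix x assume "x \<in> range (signed b)"
  then obtain S where S: "x = signed b S" by blast
  have "fun_mat (\<lambda>k. if k \<in> S then 1 else -1) \<in> carrier (orthogonal_centralizer A)"
    unfolding orthogonal_centralizer_eq
    by (auto simp: conj_sym_def sg_id intro!: exI[of _ "\<lambda>k. if k \<in> S then 1 else -1"])
  then show "x \<in> {R *v b | R. R \<in> carrier (orthogonal_centralizer A)}"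
    unfolding S signed_def by blast
qed

text \<open>At the shared index \<open>k0\<close> neither vector is flipped, which forces the scalar
  to be 1 and rules out opposite vectors.\<close>

lemma signed_proportional:
  assumes nz: "\<And>k. coord b k \<noteq> 0" and "k0 \<in> S" "k0 \<in> S'" "signed b S' = c *\<^sub>R signed b S"
  shows "S' = S"
proof -
  have scale: "coord (c *\<^sub>R x) k = of_real c * coord x k" for x k
    by (simp add: coord_def sum_distrib_left mult_ac)
  have eq: "coord (signed b S') k = of_real c * coord (signed b S) k" for k
    using assms(4) by (simp add: scale)
  have "c = 1" using eq[of k0] assms(2,3) nz[of k0] by (simp add: coord_signed)
  then have "(if k \<in> S' then coord b k else - coord b k) = (if k \<in> S then coord b k else - coord b k)" for k
    using eq[of k] by (simp add: coord_signed)
  moreover have "coord b k \<noteq> - coord b k" for k using nz[of k] by (simp add: eq_neg_iff_add_eq_0)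
  ultimately have "k \<in> S' \<longleftrightarrow> k \<in> S" for k by metis
  then show ?thesis by blast
qed

lemma signed_Compl: "signed b (- S) = - signed b S"
proof (rule coord_inject, rule ext)
  fix k
  have "coord (- x) k = - coord x k" for x by (simp add: coord_def sum_negf)
  then show "coord (signed b (- S)) k = coord (- signed b S) k" by (simp add: coord_signed)
qed

lemma card_signed:
  assumes nz: "\<And>k. coord b k \<noteq> 0"
  shows "card (range (signed b)) = 2 ^ CARD('n)"
    and "card ((\<lambda>x. span {x}) ` range (signed b)) = 2 ^ (CARD('n) - 1)"
proof -
  have inj: "inj (signed b)"
  proof (rule injI)
    fix S S' assume eq: "signed b S = signed b S'"
    have "coord b k \<noteq> - coord b k" for k using nz[of k] by (simp add: eq_neg_iff_add_eq_0)
    then have "k \<in> S \<longleftrightarrow> k \<in> S'" for k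
      using arg_cong[OF eq, of "\<lambda>x. coord x k"] unfolding coord_signed by metis
    then show "S = S'" by blast
  qed
  then show "card (range (signed b)) = 2 ^ CARD('n)"
    using card_Pow[of "UNIV :: 'n set"] by (simp add: card_image)
  obtain k0 :: 'n where True by simp
  \<comment> \<open>Complementary sets give opposite vectors and so the same line; the sets
    containing \<open>k0\<close> form one representative of each complementary pair.\<close>
  let ?P = "insert k0 ` Pow (UNIV - {k0})"
  have P: "S \<in> ?P" if "k0 \<in> S" for S
    using that by (intro image_eqI[of _ _ "S - {k0}"]) auto
  have neg: "span {signed b (- S)} = span {signed b S}" for S
    using span_image_scale[of "{signed b S}" "\<lambda>_. -1"] by (simp add: signed_Compl)
  have "span {signed b S} \<in> (\<lambda>S. span {signed b S}) ` ?P" for S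
  proof (cases "k0 \<in> S")
    case True
    then show ?thesis by (intro imageI P)
  next
    case False
    then show ?thesis unfolding neg[of S, symmetric] by (intro imageI P) simp
  qed
  then have "(\<lambda>x. span {x}) ` range (signed b) = (\<lambda>S. span {signed b S}) ` ?P"
    unfolding image_image by (intro subset_antisym image_subsetI image_mono) simp_all
  moreover have "inj_on (\<lambda>S. span {signed b S}) ?P"
  proof (rule inj_onI)
    fix S S' assume S: "S \<in> ?P" "S' \<in> ?P" and eq: "span {signed b S} = span {signed b S'}"
    have "signed b S \<in> span {signed b S'}" unfolding eq[symmetric] by (rule span_base) simp
    then obtain c where "signed b S = c *\<^sub>R signed b S'" unfolding span_singleton by blast
    then show "S = S'" using S by (intro signed_proportional[OF nz, of k0]) auto
  qed
  moreover have "card ?P = 2 ^ (CARD('n) - 1)"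
    by (subst card_image) (auto simp: inj_on_def card_Pow)
  ultimately show "card ((\<lambda>x. span {x}) ` range (signed b)) = 2 ^ (CARD('n) - 1)"
    by (simp add: card_image)
qed

end

end

theorem mainTheorem4:
  fixes A :: "real^'n^'n"
  assumes "normal_matrix A" and "simple_spectrum A"
  shows "(\<exists>T0>0. \<forall>T. 0 < T \<and> T < T0 \<longrightarrow>
            (\<forall>b0. norm b0 = 1 \<and> lambda_min (gramian T A b0) = gamma1 A T \<longrightarrow>
               {b. norm b = 1 \<and> lambda_min (gramian T A b) = gamma1 A T} =
               {R *v b0 | R. R \<in> carrier (orthogonal_centralizer A)}))
       \<and> (\<forall>r q. r = card {z \<in> complex_spectrum A. z \<in> \<real>} \<and>
                q = card {{z, cnj z} | z. z \<in> complex_spectrum A \<and> z \<notin> \<real>} \<longrightarrow>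
            (\<exists>f. f \<in> iso (orthogonal_centralizer A) (sign_circle_group r q) \<and>
                 homeomorphic_map (top_of_set (carrier (orthogonal_centralizer A)))
                   (sign_circle_topology r q) f))
       \<and> (transpose A = A \<longrightarrow>
            (\<exists>T0>0. \<forall>T. 0 < T \<and> T < T0 \<longrightarrow>
               card {b. norm b = 1 \<and> lambda_min (gramian T A b) = gamma1 A T} = 2 ^ CARD('n) \<and>
               card {span {b} | b. norm b = 1 \<and> lambda_min (gramian T A b) = gamma1 A T}
                 = 2 ^ (CARD('n) - 1)))"
proof -
  obtain e v sg where "eigenframe A e v sg" using eigenframe_exists[OF assms] by blast
  then interpret eigenframe A e v sg .
  let ?M = "\<lambda>T. {b. norm b = 1 \<and> lambda_min (gramian T A b) = gamma1 A T}"
  obtain T0 where "T0 > 0" and T0: "\<And>T. 0 < T \<Longrightarrow> T < T0 \<Longrightarrow> 0 < gamma1 A T \<and>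
      (\<forall>b0. norm b0 = 1 \<and> lambda_min (gramian T A b0) = gamma1 A T \<longrightarrow>
        ?M T = {R *v b0 | R. R \<in> carrier (orthogonal_centralizer A)})"
    using maximisers_orbit unfolding eventually_at_right_field by meson
  have orbit: "?M T = {R *v b0 | R. R \<in> carrier (orthogonal_centralizer A)}"
    if "0 < T" "T < T0" "norm b0 = 1 \<and> lambda_min (gramian T A b0) = gamma1 A T" for T b0
    using T0[OF that(1,2), THEN conjunct2, THEN spec, THEN mp, OF that(3)] .
  have count: "card (?M T) = 2 ^ CARD('n) \<and>
      card {span {b} | b. norm b = 1 \<and> lambda_min (gramian T A b) = gamma1 A T} = 2 ^ (CARD('n) - 1)"
    if A: "transpose A = A" and T: "0 < T" "T < T0" for T
  proof -
    \<comment> \<open>The orbit description only speaks about a given maximiser; attainment supplies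
      one, so the set counted is not empty.\<close>
    obtain b where b: "norm b = 1 \<and> lambda_min (gramian T A b) = gamma1 A T" using gamma1_attained by blast
    have nz: "coord b k \<noteq> 0" for k
      by (rule maximiser_coord_nonzero[of T]) (use T0[OF T] b in simp)
    have M: "?M T = range (signed b)"
      unfolding orbit[OF T b] by (rule centralizer_orbit_signed[OF symmetric_sg[OF A]])
    show ?thesis
      unfolding setcompr_eq_image M using card_signed[OF symmetric_sg[OF A] nz] by (rule conjI)
  qed
  show ?thesis
  proof (intro conjI)
    show "\<exists>T0>0. \<forall>T. 0 < T \<and> T < T0 \<longrightarrow>
            (\<forall>b0. norm b0 = 1 \<and> lambda_min (gramian T A b0) = gamma1 A T \<longrightarrow>
               ?M T = {R *v b0 | R. R \<in> carrier (orthogonal_centralizer A)})"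
      by (rule exI[of _ T0], rule conjI[OF \<open>T0 > 0\<close>], intro allI impI, elim conjE) (rule orbit, auto)
  next
    show "\<forall>r q. r = card {z \<in> complex_spectrum A. z \<in> \<real>} \<and>
                q = card {{z, cnj z} | z. z \<in> complex_spectrum A \<and> z \<notin> \<real>} \<longrightarrow>
            (\<exists>f. f \<in> iso (orthogonal_centralizer A) (sign_circle_group r q) \<and>
                 homeomorphic_map (top_of_set (carrier (orthogonal_centralizer A)))
                   (sign_circle_topology r q) f)"
      by (intro allI impI, elim conjE) (rule orthogonal_centralizer_iso)
  next
    show "transpose A = A \<longrightarrow>
            (\<exists>T0>0. \<forall>T. 0 < T \<and> T < T0 \<longrightarrow>
               card (?M T) = 2 ^ CARD('n) \<and>
               card {span {b} | b. norm b = 1 \<and> lambda_min (gramian T A b) = gamma1 A T} = 2 ^ (CARD('n) - 1))"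
      by (rule impI, rule exI[of _ T0], rule conjI[OF \<open>T0 > 0\<close>], intro allI impI, elim conjE) (rule count)
  qed
qed

end
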